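(* For all $M,\rho>0$ there exists $T^*>0$ such that, for every $T\in(0,T^* )$ and for every $f\in E_T$ with $\|f\|_{E_T}\le M$, there exists a solution $z=(z_1,z_2,z_3):(0,T)\to\mathbb{C}^3\setminus\triangle^3$ of class $C^1$ of the equation $$\dot{\bar z}_j=\frac1{2\pi i}\sum_{k\in\{1,2,3\},\,k\neq j}\frac{\xi_k}{z_j-z_k}+f(t,z_j),\qquad t\in(0,T),\quad j=1,2,3,$$ such that $\lim_{t\to0}z_j(t)=0$ and $[z_j]_{C^{1/2}((0,T),\mathbb{C})}\le 3\,[w_j]_{C^{1/2}((0,\infty),\mathbb{C})}$ for every $j=1,2,3$, and $$\sup_{0<t<T}|z(t)|\le\rho.$$
   Context: Fix $\xi\in\mathbb{R}\setminus\{0\}$ and set $\xi_1=-\frac13\xi$, $\xi_2=\xi_3=\frac23\xi$. Fix the following parameters: if $\xi>0$, $$a=\tfrac{\sqrt3}{84\pi}\xi,\quad b=\tfrac{5}{84\pi}\xi,\quad a_1=-2+2\sqrt3\,i,\quad a_2=-2+\sqrt3\,i,\quad a_3=1;$$ if $\xi<0$, $$a=-\tfrac{\sqrt3}{84\pi}\xi,\quad b=\tfrac{5}{84\pi}\xi,\quad a_1=2+2\sqrt3\,i,\quad a_2=2+\sqrt3\,i,\quad a_3=-1.$$ They satisfy $\sum_{k\ne j}\frac{\xi_k}{a_j-a_k}=2\pi i\,\bar a_j(a-ib)$ for $j=1,2,3$. The self-similar burst is $w_j(t)=a_jZ(t)$, $Z(t)=\sqrt{2at}\,e^{i\frac{b}{2a}\log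 t}$, $t>0$, $j=1,2,3$. $\triangle^3=\{(p_1,p_2,p_3)\in\mathbb{C}^3: p_i=p_j\text{ for some }i\ne j\}$. A bar denotes complex conjugation. For an interval $I$ and a Banach space $X$, $[g]_{C^{1/2}(I,X)}=\sup_{s\ne t\in I}\|g(t)-g(s)\|_X/|t-s|^{1/2}$ and $[g]_{\mathrm{Lip}(I,X)}=\sup_{s\ne t\in I}\|g(t)-g(s)\|_X/|t-s|$. $C(\mathbb{C},\mathbb{C})$ carries the sup norm, and $C^2(\mathbb{C},\mathbb{C})$ carries the norm $\|h\|_{C^2}=\|h\|_\infty+\|Dh\|_\infty+\|D^2h\|_\infty$ (derivatives are real derivatives, with $\mathbb{C}=\mathbb{R}^2$). For $T>0$, $E_T=C([0,T),C^2(\mathbb{C},\mathbb{C}))\cap\mathrm{Lip}([0,T),C(\mathbb{C},\mathbb{C}))$, a space of functions $f(t,p)=f_t(p)$ with norm $\|f\|_{E_T}=\sup_{t\in[0,T)}\|f_t\|_{C^2}+[f]_{\mathrm{Lip}([0,T),C(\mathbb{C},\mathbb{C}))}$. *)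

theory Defs
  imports "HOL-Analysis.Analysis"
begin

definition circ :: "real \<Rightarrow> real ^ 3" where
  "circ \<xi> = vector [- \<xi> / 3, 2 * \<xi> / 3, 2 * \<xi> / 3]"

definition burst_a :: "real \<Rightarrow> real" where
  "burst_a \<xi> = (if \<xi> > 0 then sqrt 3 / (84 * pi) * \<xi> else - (sqrt 3 / (84 * pi)) * \<xi>)"

definition burst_b :: "real \<Rightarrow> real" where
  "burst_b \<xi> = 5 / (84 * pi) * \<xi>"

definition burst_coeff :: "real \<Rightarrow> complex ^ 3" where
  "burst_coeff \<xi> =
    (if \<xi> > 0
     then vector [- 2 + 2 * complex_of_real (sqrt 3) * \<i>, - 2 + complex_of_real (sqrt 3) * \<i>, 1]
     else vector [2 + 2 * complex_of_real (sqrt 3) * \<i>, 2 + complex_of_real (sqrt 3) * \<i>, - 1])"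

definition burst_Z :: "real \<Rightarrow> real \<Rightarrow> complex" where
  "burst_Z \<xi> t = complex_of_real (sqrt (2 * burst_a \<xi> * t)) *
     exp (\<i> * complex_of_real (burst_b \<xi> / (2 * burst_a \<xi>) * ln t))"

definition burst :: "real \<Rightarrow> real \<Rightarrow> complex ^ 3" where
  "burst \<xi> t = (\<chi> j. burst_coeff \<xi> $ j * burst_Z \<xi> t)"

definition diagonal3 :: "(complex ^ 3) set" where
  "diagonal3 = {p. \<exists>i j. i \<noteq> j \<and> p $ i = p $ j}"

(* Norms and seminorms take values in ennreal, so that an infinite supremum is \<infinity> and not
   an unspecified real number. *)

definition holder_seminorm ::
    "('x::minus \<Rightarrow> ennreal) \<Rightarrow> real \<Rightarrow> real set \<Rightarrow> (real \<Rightarrow> 'x) \<Rightarrow> ennreal" where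
  "holder_seminorm N \<alpha> I g =
     (SUP (s, t) \<in> {(s, t). s \<in> I \<and> t \<in> I \<and> s \<noteq> t}. N (g t - g s) / ennreal (\<bar>t - s\<bar> powr \<alpha>))"

abbreviation C_half_seminorm :: "real set \<Rightarrow> (real \<Rightarrow> complex) \<Rightarrow> ennreal" where
  "C_half_seminorm \<equiv> holder_seminorm (\<lambda>x. ennreal (norm x)) (1 / 2)"

definition sup_norm :: "('a \<Rightarrow> 'b::real_normed_vector) \<Rightarrow> ennreal" where
  "sup_norm h = (SUP p. ennreal (norm (h p)))"

(* The real Frechet derivative as a map into the bounded linear maps with the operator norm;
   meaningful only where h is differentiable. *)
definition Dreal :: "(complex \<Rightarrow> 'b::real_normed_vector) \<Rightarrow> complex \<Rightarrow> (complex \<Rightarrow>\<^sub>L 'b)" where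
  "Dreal h p = Blinfun (frechet_derivative h (at p))"

definition C2_norm :: "(complex \<Rightarrow> complex) \<Rightarrow> ennreal" where
  "C2_norm h = sup_norm h + sup_norm (Dreal h) + sup_norm (Dreal (Dreal h))"

definition C2_space :: "(complex \<Rightarrow> complex) set" where
  "C2_space = {h. (\<forall>p. h differentiable (at p)) \<and> (\<forall>p. Dreal h differentiable (at p)) \<and>
                  continuous_on UNIV (Dreal (Dreal h)) \<and> C2_norm h < \<infinity>}"

definition E_norm :: "real \<Rightarrow> (real \<Rightarrow> complex \<Rightarrow> complex) \<Rightarrow> ennreal" where
  "E_norm T f = (SUP t \<in> {0..<T}. C2_norm (f t)) + holder_seminorm sup_norm 1 {0..<T} f"

(* Functions on [0,T) are represented by functions on the reals with arbitrary values elsewhere. *)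
definition E_space :: "real \<Rightarrow> (real \<Rightarrow> complex \<Rightarrow> complex) set" where
  "E_space T = {f. (\<forall>t\<in>{0..<T}. f t \<in> C2_space) \<and>
                   (\<forall>t\<in>{0..<T}. ((\<lambda>s. C2_norm (f s - f t)) \<longlongrightarrow> 0) (at t within {0..<T})) \<and>
                   E_norm T f < \<infinity>}"

end

theory Submission
  imports Defs
begin

text \<open>
  In the self-similar variables \<open>t = exp \<tau>\<close>, \<open>z\<^sub>j = Z(t) (a\<^sub>j + y\<^sub>j)\<close> the system becomes autonomous up to the
  force, which is of size \<open>exp (\<tau> / 2)\<close>: \<open>y' = L y + O(\<bar>y\<bar>\<^sup>2) + O(exp (\<tau> / 2))\<close>. The eigenvalues of the real-linear
  map \<open>L\<close> have real parts in \<open>{-1, -1/2, 0}\<close>, so after the rescaling \<open>y = exp (\<tau> / 4) v\<close> the linear part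
  \<open>L - 1/4\<close> is exponentially stable, while the quadratic and force terms both gain the factor
  \<open>exp (\<tau> / 4)\<close>, which is small for \<open>\<tau> \<le> ln T\<close>. A bounded \<open>v\<close> then exists by Banach's fixed point theorem
  applied to Duhamel's formula started at \<open>\<tau> = -\<infinity>\<close>. The perturbation \<open>r\<^sub>j = Z y\<^sub>j\<close> satisfies
  \<open>\<bar>r\<^sub>j'\<bar> \<le> \<delta> / sqrt t\<close> with \<open>\<delta>\<close> as small as we like, which adds at most \<open>2 \<delta>\<close> to the \<open>C\<^sup>1\<^sup>/\<^sup>2\<close> seminorm.
  The case \<open>\<xi> < 0\<close> follows from \<open>\<xi> > 0\<close> by the reflection \<open>z \<mapsto> - cnj z\<close>.
\<close>

section \<open>Bounded solutions of linear equations on the whole line\<close>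

text \<open>The obstacle is the eigenvalue 0. It comes from rotation invariance, just as -1 and
  \<open>- \<kappa>\<close> come from translation in time and in space. Without decay, the integral
  from \<open>-\<infinity>\<close> of a merely bounded force can diverge. A weight
  \<open>exp (c * \<tau>)\<close> with c > 0 moves 0 to -c, and c < 1/2 still leaves the force a
  decaying factor \<open>exp ((1/2 - c) * \<tau>)\<close>; the rate 1/4 balances the two. The
  complex conjugate in the equation makes the linear part only real-linear, so it is not a complex
  matrix whose eigenvalues could be read off. What is used instead is an explicit real polynomial
  that annihilates the relative part; its roots are real, and scalar Duhamel integrals then replace
  the matrix exponential. The factor 3 arises as follows. Every burst coefficient has modulus at
  least 1, so each \<open>[w_j]\<close> is at least sqrt (2a). With
  \<open>\<delta> = sqrt (2a)\<close> the perturbation adds at most \<open>2 * \<delta>\<close>,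
  hence at most \<open>2 [w_j]\<close>, to the seminorm of the burst.\<close>

definition bounded_cont :: "real \<Rightarrow> (real \<Rightarrow> 'v::euclidean_space) \<Rightarrow> bool" where
  "bounded_cont B g \<longleftrightarrow> continuous_on UNIV g \<and> (\<forall>\<tau>. norm (g \<tau>) \<le> B)"

text \<open>The integral of \<open>exp (- \<delta> (\<tau> - s)) g s\<close> over \<open>s \<le> \<tau>\<close>, written in reversed time.\<close>

definition duhamel :: "real \<Rightarrow> (real \<Rightarrow> 'v::euclidean_space) \<Rightarrow> real \<Rightarrow> 'v" where
  "duhamel \<delta> g \<tau> = exp (- \<delta> * \<tau>) *\<^sub>R integral {- \<tau>..} (\<lambda>s. exp (- \<delta> * s) *\<^sub>R g (- s))"

lemma exp_weighted_continuous:
  fixes g :: "real \<Rightarrow> 'v::real_normed_vector"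
  assumes "continuous_on UNIV g"
  shows "continuous_on A (\<lambda>s. exp (- \<delta> * s) *\<^sub>R g (- s))"
proof -
  have "continuous_on A (\<lambda>s. g (- s))"
    by (rule continuous_on_compose2[OF assms]) (auto intro!: continuous_intros)
  then show ?thesis
    by (auto intro!: continuous_intros)
qed

lemma exp_weighted_integrable:
  assumes "\<delta> > 0" "bounded_cont B g"
  shows "(\<lambda>s. exp (- \<delta> * s) *\<^sub>R g (- s)) integrable_on {c..}"
proof (rule measurable_bounded_by_integrable_imp_integrable)
  show "(\<lambda>s. exp (- \<delta> * s) *\<^sub>R g (- s)) \<in> borel_measurable (lebesgue_on {c..})"
    using assms(2) unfolding bounded_cont_def
    by (intro continuous_imp_measurable_on_sets_lebesgue exp_weighted_continuous) auto
  show "(\<lambda>s. B * exp (- \<delta> * s)) integrable_on {c..}"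
    using integrable_on_cmult_left[OF integrable_on_exp_minus_to_infinity[OF assms(1)], of B] by simp
  show "norm (exp (- \<delta> * s) *\<^sub>R g (- s)) \<le> B * exp (- \<delta> * s)" for s
    using assms(2) by (simp add: bounded_cont_def mult.commute)
qed auto

lemma norm_duhamel_le:
  assumes "\<delta> > 0" "bounded_cont B g"
  shows "norm (duhamel \<delta> g \<tau>) \<le> B / \<delta>"
proof -
  have "norm (integral {- \<tau>..} (\<lambda>s. exp (- \<delta> * s) *\<^sub>R g (- s)))
      \<le> integral {- \<tau>..} (\<lambda>s. B * exp (- \<delta> * s))"
  proof (rule integral_norm_bound_integral)
    show "(\<lambda>s. B * exp (- \<delta> * s)) integrable_on {- \<tau>..}"
      using integrable_on_cmult_left[OF integrable_on_exp_minus_to_infinity[OF assms(1)], of B] by simp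
    show "norm (exp (- \<delta> * s) *\<^sub>R g (- s)) \<le> B * exp (- \<delta> * s)" for s
      using assms(2) by (simp add: bounded_cont_def mult.commute)
  qed (rule exp_weighted_integrable[OF assms])
  also have "\<dots> = B * (exp (\<delta> * \<tau>) / \<delta>)"
    using has_integral_exp_minus_to_infinity[OF assms(1), of "- \<tau>"] by (simp add: integral_unique)
  finally show ?thesis
    unfolding duhamel_def by (simp add: exp_minus field_simps)
qed

text \<open>The half-line is cut at the fixed point \<open>1 - \<tau>\<close>. Only the compact
  piece then varies with \<open>x\<close>; reflected, it is an integral with variable upper limit,
  to which the fundamental theorem applies.\<close>

lemma duhamel_has_vector_derivative:
  assumes "\<delta> > 0" "bounded_cont B g"
  shows "(duhamel \<delta> g has_vector_derivative (- \<delta>) *\<^sub>R duhamel \<delta> g \<tau> + g \<tau>) (at \<tau>)"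
proof -
  let ?e = "\<lambda>s. exp (\<delta> * s) *\<^sub>R g s"
  let ?r = "\<lambda>s. exp (- \<delta> * s) *\<^sub>R g (- s)"
  define I where "I = integral {1 - \<tau>..} ?r"
  have cont: "continuous_on UNIV g"
    using assms(2) by (simp add: bounded_cont_def)
  have split: "integral {- x..} ?r = I + integral {\<tau> - 1..x} ?e" if "x \<in> {\<tau> - 1<..}" for x
  proof -
    have "{- x..} = {- x..1 - \<tau>} \<union> {1 - \<tau>..}"
      using that by auto
    moreover have "integral ({- x..1 - \<tau>} \<union> {1 - \<tau>..}) ?r
        = integral {- x..1 - \<tau>} ?r + integral {1 - \<tau>..} ?r"
    proof (rule integral_Un)
      show "?r integrable_on {- x..1 - \<tau>}"
        by (intro integrable_continuous_real exp_weighted_continuous[OF cont])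
      have "{- x..1 - \<tau>} \<inter> {1 - \<tau>..} \<subseteq> {1 - \<tau>}"
        by auto
      then show "negligible ({- x..1 - \<tau>} \<inter> {1 - \<tau>..})"
        using negligible_subset negligible_sing by blast
    qed (rule exp_weighted_integrable[OF assms])
    moreover have "integral {- x..1 - \<tau>} ?r = integral {\<tau> - 1..x} ?e"
      using Henstock_Kurzweil_Integration.integral_reflect_real[of x "\<tau> - 1" ?e] by simp
    ultimately show ?thesis by (simp add: I_def)
  qed
  have "((\<lambda>x. integral {\<tau> - 1..x} ?e) has_vector_derivative ?e \<tau>) (at \<tau> within {\<tau> - 1..\<tau> + 1})"
    by (rule integral_has_vector_derivative)
      (auto intro!: continuous_intros continuous_on_subset[OF cont])
  then have "((\<lambda>x. integral {\<tau> - 1..x} ?e) has_vector_derivative ?e \<tau>) (at \<tau>)"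
    by (simp add: at_within_Icc_at)
  then have "((\<lambda>x. I + integral {\<tau> - 1..x} ?e) has_vector_derivative ?e \<tau>) (at \<tau>)"
    by (auto intro!: derivative_eq_intros)
  then have "((\<lambda>x. integral {- x..} ?r) has_vector_derivative ?e \<tau>) (at \<tau>)"
    by (rule has_vector_derivative_transform_within_open[where S = "{\<tau> - 1<..}"])
      (use split in auto)
  then have "((\<lambda>x. exp (- \<delta> * x) *\<^sub>R integral {- x..} ?r) has_vector_derivative
      exp (- \<delta> * \<tau>) *\<^sub>R ?e \<tau> + (exp (- \<delta> * \<tau>) * - \<delta>) *\<^sub>R integral {- \<tau>..} ?r) (at \<tau>)"
    by (intro has_vector_derivative_scaleR) (auto intro!: derivative_eq_intros)
  then show ?thesis
    unfolding duhamel_def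
    by (simp add: duhamel_def[abs_def] exp_minus field_simps flip: exp_add)
qed

lemma duhamel_bounded_cont:
  assumes "\<delta> > 0" "bounded_cont B g"
  shows "bounded_cont (B / \<delta>) (duhamel \<delta> g)"
  unfolding bounded_cont_def
  using norm_duhamel_le[OF assms] duhamel_has_vector_derivative[OF assms]
  by (auto intro!: continuous_at_imp_continuous_on has_vector_derivative_continuous)

lemma duhamel_diff:
  assumes "\<delta> > 0" "bounded_cont B g" "bounded_cont B' h"
  shows "duhamel \<delta> (\<lambda>\<tau>. g \<tau> - h \<tau>) \<tau> = duhamel \<delta> g \<tau> - duhamel \<delta> h \<tau>"
  unfolding duhamel_def
  using integral_diff[OF exp_weighted_integrable[OF assms(1,2)] exp_weighted_integrable[OF assms(1,3)]]
  by (simp add: scaleR_diff_right)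

text \<open>The exponential weights are real scalars, so a bounded real-linear map passes through
  them and the integral. In the cascade this transfers the annihilation of the force to the
  residual.\<close>

lemma duhamel_linear:
  assumes "\<delta> > 0" "bounded_cont B g" "bounded_linear A"
  shows "duhamel \<delta> (\<lambda>\<tau>. A (g \<tau>)) \<tau> = A (duhamel \<delta> g \<tau>)"
proof -
  interpret A: bounded_linear A by fact
  show ?thesis
    unfolding duhamel_def
    using integral_linear[OF exp_weighted_integrable[OF assms(1,2)] assms(3), of "- \<tau>"]
    by (simp add: A.scaleR o_def)
qed

section \<open>Solution operators for bounded solutions on the whole line\<close>

lemma bounded_cont_linear:
  assumes "bounded_linear A"
  shows "\<exists>K>0. \<forall>B g. bounded_cont B g \<longrightarrow> bounded_cont (K * B) (\<lambda>\<tau>. A (g \<tau>))"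
proof -
  obtain K where K: "K > 0" "\<And>x. norm (A x) \<le> norm x * K"
    using bounded_linear.pos_bounded[OF assms] by blast
  have "norm (A (g \<tau>)) \<le> K * B" if "bounded_cont B g" for g B \<tau>
  proof -
    have "norm (g \<tau>) * K \<le> B * K"
      using that K(1) by (intro mult_right_mono) (auto simp: bounded_cont_def)
    then show ?thesis using K(2)[of "g \<tau>"] by (simp add: mult.commute)
  qed
  moreover have "continuous_on UNIV (\<lambda>\<tau>. A (g \<tau>))" if "bounded_cont B g" for g B
    using that by (intro bounded_linear.continuous_on[OF assms]) (simp add: bounded_cont_def)
  ultimately show ?thesis
    using K(1) unfolding bounded_cont_def by blast
qed

text \<open>Compatibility with differences is the form of linearity that the contraction estimate
  consumes. The explicit bound \<open>B\<close> makes \<open>C\<close> an operator norm for the sup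
  norm.\<close>

definition solution_operator ::
    "('v::euclidean_space \<Rightarrow> 'v) \<Rightarrow> real \<Rightarrow> ((real \<Rightarrow> 'v) \<Rightarrow> real \<Rightarrow> 'v) \<Rightarrow> bool" where
  "solution_operator L C S \<longleftrightarrow> C > 0 \<and>
     (\<forall>B g. bounded_cont B g \<longrightarrow>
        bounded_cont (C * B) (S g) \<and>
        (\<forall>\<tau>. (S g has_vector_derivative L (S g \<tau>) + g \<tau>) (at \<tau>))) \<and>
     (\<forall>B B' g h. bounded_cont B g \<longrightarrow> bounded_cont B' h \<longrightarrow>
        (\<forall>\<tau>. S (\<lambda>\<sigma>. g \<sigma> - h \<sigma>) \<tau> = S g \<tau> - S h \<tau>))"

text \<open>Solving \<open>h' = \<mu> h + g\<close> instead of \<open>h' = L h + g\<close> leaves the residual force \<open>(L - \<mu>) h\<close>. Iterating over the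
  roots \<open>\<mu>\<close> of a polynomial annihilating \<open>L\<close> makes the residual vanish.\<close>

primrec shift_prod :: "('v \<Rightarrow> 'v) \<Rightarrow> real list \<Rightarrow> 'v \<Rightarrow> 'v::real_normed_vector" where
  "shift_prod L [] x = x"
| "shift_prod L (\<mu> # \<mu>s) x = shift_prod L \<mu>s (L x - \<mu> *\<^sub>R x)"

primrec cascade :: "('v \<Rightarrow> 'v) \<Rightarrow> real list \<Rightarrow> (real \<Rightarrow> 'v) \<Rightarrow> real \<Rightarrow> 'v::euclidean_space" where
  "cascade L [] g \<tau> = 0"
| "cascade L (\<mu> # \<mu>s) g \<tau> = duhamel (- \<mu>) g \<tau> +
     cascade L \<mu>s (\<lambda>\<sigma>. L (duhamel (- \<mu>) g \<sigma>) - \<mu> *\<^sub>R duhamel (- \<mu>) g \<sigma>) \<tau>"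

lemma bounded_linear_shift:
  "bounded_linear L \<Longrightarrow> bounded_linear (\<lambda>x. L x - \<mu> *\<^sub>R x)"
  by (intro bounded_linear_sub bounded_linear_scaleR_right)

lemma bounded_linear_shift_prod:
  assumes "bounded_linear L"
  shows "bounded_linear (shift_prod L \<mu>s)"
proof (induction \<mu>s)
  case Nil
  then show ?case by (simp add: bounded_linear_ident[unfolded id_def])
next
  case (Cons \<mu> \<mu>s)
  then show ?case
    using bounded_linear_compose[OF Cons bounded_linear_shift[OF assms, of \<mu>]] by (simp add: o_def)
qed

lemma bounded_cont_add:
  "bounded_cont B g \<Longrightarrow> bounded_cont B' h \<Longrightarrow> bounded_cont (B + B') (\<lambda>\<tau>. g \<tau> + h \<tau>)"
  unfolding bounded_cont_def by (auto intro!: continuous_intros norm_triangle_mono)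

lemma cascade_bounded_cont:
  assumes L: "bounded_linear L" and neg: "\<forall>\<mu>\<in>set \<mu>s. \<mu> < 0"
  shows "\<exists>C>0. \<forall>B g. bounded_cont B g \<longrightarrow> bounded_cont (C * B) (cascade L \<mu>s g)"
  using neg
proof (induction \<mu>s)
  case Nil
  have "0 \<le> B" if "bounded_cont B g" for B and g :: "real \<Rightarrow> 'a"
    using that norm_ge_zero order_trans unfolding bounded_cont_def by blast
  then show ?case
    by (intro exI[of _ 1]) (auto simp: bounded_cont_def)
next
  case (Cons \<mu> \<mu>s)
  then obtain C where C: "C > 0"
    "\<And>B g. bounded_cont B g \<Longrightarrow> bounded_cont (C * B) (cascade L \<mu>s g)" by auto
  obtain K where K: "K > 0" "\<And>B g. bounded_cont B g \<Longrightarrow>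
      bounded_cont (K * B) (\<lambda>\<tau>. L (g \<tau>) - \<mu> *\<^sub>R g \<tau>)"
    using bounded_cont_linear[OF bounded_linear_shift[OF L]] by blast
  have mu: "- \<mu> > 0" using Cons by simp
  have "bounded_cont (B / - \<mu> + C * (K * (B / - \<mu>))) (cascade L (\<mu> # \<mu>s) g)"
    if "bounded_cont B g" for B g
    using bounded_cont_add[OF duhamel_bounded_cont[OF mu that]
        C(2)[OF K(2)[OF duhamel_bounded_cont[OF mu that]]]]
    by (simp add: bounded_cont_def)
  moreover have "B / - \<mu> + C * (K * (B / - \<mu>)) = (1 + C * K) / - \<mu> * B" for B
    using mu by (simp add: field_simps)
  moreover have "(1 + C * K) / - \<mu> > 0"
    using mu C(1) K(1) by (intro divide_pos_pos add_pos_pos mult_pos_pos) auto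
  ultimately show ?case by metis
qed

lemma cascade_diff:
  assumes L: "bounded_linear L" and "\<forall>\<mu>\<in>set \<mu>s. \<mu> < 0" "bounded_cont B g" "bounded_cont B' h"
  shows "cascade L \<mu>s (\<lambda>\<sigma>. g \<sigma> - h \<sigma>) \<tau> = cascade L \<mu>s g \<tau> - cascade L \<mu>s h \<tau>"
  using assms(2-)
proof (induction \<mu>s arbitrary: g h B B' \<tau>)
  case (Cons \<mu> \<mu>s)
  interpret L: bounded_linear L by fact
  obtain K where K: "\<And>B g. bounded_cont B g \<Longrightarrow>
      bounded_cont (K * B) (\<lambda>\<tau>. L (g \<tau>) - \<mu> *\<^sub>R g \<tau>)"
    using bounded_cont_linear[OF bounded_linear_shift[OF L]] by blast
  have mu: "- \<mu> > 0" using Cons by simp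
  note gh = Cons.prems(2,3)
  show ?case
    using Cons.IH[OF _ K[OF duhamel_bounded_cont[OF mu gh(1)]] K[OF duhamel_bounded_cont[OF mu gh(2)]]]
      Cons.prems(1)
    by (simp add: duhamel_diff[OF mu gh] L.diff scaleR_diff_right algebra_simps)
qed simp

text \<open>The head \<open>h\<close> solves \<open>h' = \<mu> h + g\<close>, and by induction the
  tail solves the equation with force \<open>L h - \<mu> h\<close>. In the sum the terms
  \<open>\<mu> h\<close> cancel.\<close>

lemma cascade_has_vector_derivative:
  assumes L: "bounded_linear L" and "\<forall>\<mu>\<in>set \<mu>s. \<mu> < 0" "bounded_cont B g"
    "\<And>\<tau>. shift_prod L \<mu>s (g \<tau>) = 0"
  shows "(cascade L \<mu>s g has_vector_derivative L (cascade L \<mu>s g \<tau>) + g \<tau>) (at \<tau>)"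
  using assms(2-)
proof (induction \<mu>s arbitrary: g B)
  case Nil
  interpret L: bounded_linear L by fact
  \<comment> \<open>The empty product is the identity, so the hypothesis says \<open>g = 0\<close>,
    and the value 0 of the empty cascade is a solution.\<close>
  show ?case using Nil by (simp add: L.zero)
next
  case (Cons \<mu> \<mu>s)
  interpret L: bounded_linear L by fact
  define h where "h = duhamel (- \<mu>) g"
  have mu: "- \<mu> > 0" using Cons by simp
  note gb = Cons.prems(2)
  obtain K where "bounded_cont (K * (B / - \<mu>)) (\<lambda>\<tau>. L (h \<tau>) - \<mu> *\<^sub>R h \<tau>)"
    using bounded_cont_linear[OF bounded_linear_shift[OF L]] duhamel_bounded_cont[OF mu gb]
    unfolding h_def by blast
  \<comment> \<open>The whole product commutes with \<open>duhamel\<close>, so it kills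
    \<open>h\<close> because it kills \<open>g\<close>; its first factor is the shift that produces
    the residual.\<close>
  moreover have "shift_prod L \<mu>s (L (h \<sigma>) - \<mu> *\<^sub>R h \<sigma>) = 0" for \<sigma>
    using duhamel_linear[OF mu gb bounded_linear_shift_prod[OF L, of "\<mu> # \<mu>s"], of \<sigma>]
      Cons.prems(3)
    by (simp add: h_def duhamel_def)
  ultimately have "(cascade L \<mu>s (\<lambda>\<tau>. L (h \<tau>) - \<mu> *\<^sub>R h \<tau>) has_vector_derivative
      L (cascade L \<mu>s (\<lambda>\<tau>. L (h \<tau>) - \<mu> *\<^sub>R h \<tau>) \<tau>) + (L (h \<tau>) - \<mu> *\<^sub>R h \<tau>)) (at \<tau>)"
    using Cons.IH Cons.prems(1) by auto
  moreover have "(h has_vector_derivative \<mu> *\<^sub>R h \<tau> + g \<tau>) (at \<tau>)"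
    using duhamel_has_vector_derivative[OF mu gb] by (simp add: h_def)
  ultimately show ?case
    by (auto intro!: derivative_eq_intros simp: L.add h_def)
qed

text \<open>Repeated roots are allowed, so Jordan blocks need no separate treatment.\<close>

lemma solution_operator_of_annihilator:
  assumes "bounded_linear L" "\<forall>\<mu>\<in>set \<mu>s. \<mu> < 0" "\<And>x. shift_prod L \<mu>s x = 0"
  shows "\<exists>C. solution_operator L C (cascade L \<mu>s)"
proof -
  obtain C where "C > 0" "\<And>B g. bounded_cont B g \<Longrightarrow> bounded_cont (C * B) (cascade L \<mu>s g)"
    using cascade_bounded_cont[OF assms(1,2)] by auto
  then show ?thesis
    unfolding solution_operator_def
    using cascade_diff[OF assms(1,2)] cascade_has_vector_derivative[OF assms(1,2) _ assms(3)] by blast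
qed

text \<open>The cascade handles real roots only. For a complex scalar, multiplication by the
  unimodular factor \<open>e\<close> passes to a rotating frame in which only the damping
  \<open>Re \<kappa>\<close> remains.\<close>

lemma solution_operator_complex_scalar:
  assumes "Re \<kappa> > 0"
  shows "\<exists>C S. solution_operator (\<lambda>x. - \<kappa> * x) C S"
proof -
  define e where "e = (\<lambda>\<tau>. cis (Im \<kappa> * \<tau>))"
  define S where "S = (\<lambda>g \<tau>. cnj (e \<tau>) * duhamel (Re \<kappa>) (\<lambda>\<sigma>. e \<sigma> * g \<sigma>) \<tau>)"
  have norm_e: "norm (e \<tau>) = 1" for \<tau> by (simp add: e_def)
  have ee: "cnj (e \<tau>) * (e \<tau> * x) = x" for \<tau> x
    by (simp add: e_def cis_cnj cis_mult flip: mult.assoc)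
  have cont_e: "continuous_on UNIV e"
    unfolding e_def by (intro continuous_intros)
  have twist: "bounded_cont B (\<lambda>\<sigma>. e \<sigma> * g \<sigma>)" if "bounded_cont B g" for B g
    using that cont_e unfolding bounded_cont_def
    by (auto simp: norm_mult norm_e intro!: continuous_intros)
  have e_eq: "cnj (e \<tau>) = exp (- \<i> * complex_of_real (Im \<kappa>) * complex_of_real \<tau>)" for \<tau>
    by (simp add: e_def cis_conv_exp mult.assoc exp_cnj)
  have de: "((\<lambda>\<tau>. cnj (e \<tau>)) has_vector_derivative - \<i> * Im \<kappa> * cnj (e \<tau>)) (at \<tau>)" for \<tau>
    unfolding e_eq
    by (rule has_vector_derivative_real_field) (auto intro!: derivative_eq_intros)
  have deriv: "(S g has_vector_derivative - \<kappa> * S g \<tau> + g \<tau>) (at \<tau>)"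
    if "bounded_cont B g" for B g \<tau>
  proof -
    let ?H = "duhamel (Re \<kappa>) (\<lambda>\<sigma>. e \<sigma> * g \<sigma>)"
    have "(S g has_vector_derivative cnj (e \<tau>) * (- Re \<kappa> *\<^sub>R ?H \<tau> + e \<tau> * g \<tau>)
        + (- \<i> * Im \<kappa> * cnj (e \<tau>)) * ?H \<tau>) (at \<tau>)"
      unfolding S_def
      by (intro has_vector_derivative_mult de duhamel_has_vector_derivative[OF assms twist[OF that]])
    moreover have "cnj (e \<tau>) * (- Re \<kappa> *\<^sub>R ?H \<tau> + e \<tau> * g \<tau>)
        + (- \<i> * Im \<kappa> * cnj (e \<tau>)) * ?H \<tau> = - \<kappa> * S g \<tau> + g \<tau>"
    proof -
      have "- \<kappa> * S g \<tau> = - (of_real (Re \<kappa>) + \<i> * of_real (Im \<kappa>)) * S g \<tau>"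
        by (simp add: complex_eq[symmetric])
      then show ?thesis
        using ee[of \<tau> "g \<tau>"] by (simp add: S_def scaleR_conv_of_real algebra_simps)
    qed
    ultimately show ?thesis by simp
  qed
  have "norm (S g \<tau>) \<le> 1 / Re \<kappa> * B" if "bounded_cont B g" for B g \<tau>
    using norm_duhamel_le[OF assms twist[OF that], of \<tau>] by (simp add: S_def norm_mult norm_e)
  moreover have "continuous_on UNIV (S g)" if "bounded_cont B g" for B g
    using deriv[OF that]
    by (auto intro!: continuous_at_imp_continuous_on has_vector_derivative_continuous)
  moreover have "S (\<lambda>\<sigma>. g \<sigma> - h \<sigma>) \<tau> = S g \<tau> - S h \<tau>"
    if "bounded_cont B g" "bounded_cont B' h" for B B' g h \<tau>
    using duhamel_diff[OF assms twist[OF that(1)] twist[OF that(2)], of \<tau>]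
    by (simp add: S_def right_diff_distrib)
  ultimately have "solution_operator (\<lambda>x. - \<kappa> * x) (1 / Re \<kappa>) S"
    unfolding solution_operator_def bounded_cont_def[of "1 / Re \<kappa> * _"]
    using assms deriv by simp
  then show ?thesis by blast
qed

text \<open>The first component is solved on its own and then enters the second equation as an
  additional force through \<open>P\<close>.\<close>

lemma solution_operator_triangular:
  assumes A: "solution_operator A C1 S1" and D: "solution_operator D C2 S2"
    and P: "bounded_linear P"
  shows "\<exists>C S. solution_operator (\<lambda>x. (A (fst x), D (snd x) + P (fst x))) C S"
proof -
  interpret P: bounded_linear P by fact
  obtain K where K: "K > 0" "\<And>B g. bounded_cont B g \<Longrightarrow> bounded_cont (K * B) (\<lambda>\<tau>. P (g \<tau>))"
    using bounded_cont_linear[OF P] by blast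
  define S where "S = (\<lambda>g \<tau>. (S1 (\<lambda>\<sigma>. fst (g \<sigma>)) \<tau>,
      S2 (\<lambda>\<sigma>. snd (g \<sigma>) + P (S1 (\<lambda>\<sigma>. fst (g \<sigma>)) \<sigma>)) \<tau>))"
  define C where "C = C1 + C2 * (1 + K * C1)"
  have pos: "C1 > 0" "C2 > 0"
    using A D by (auto simp: solution_operator_def)
  have fst: "bounded_cont B (\<lambda>\<sigma>. fst (g \<sigma>))" and snd: "bounded_cont B (\<lambda>\<sigma>. snd (g \<sigma>))"
    if "bounded_cont B g" for B and g :: "real \<Rightarrow> 'a \<times> 'b"
  proof -
    have "norm (fst (g \<tau>)) \<le> B \<and> norm (snd (g \<tau>)) \<le> B" for \<tau>
      using that norm_fst_le[of "fst (g \<tau>)" "snd (g \<tau>)"] norm_snd_le[of "snd (g \<tau>)" "fst (g \<tau>)"]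
        order_trans unfolding bounded_cont_def prod.collapse by blast
    then show "bounded_cont B (\<lambda>\<sigma>. fst (g \<sigma>))" "bounded_cont B (\<lambda>\<sigma>. snd (g \<sigma>))"
      using that unfolding bounded_cont_def by (auto intro: continuous_on_fst continuous_on_snd)
  qed
  have S1: "bounded_cont (C1 * B) (S1 g)"
    "\<And>\<tau>. (S1 g has_vector_derivative A (S1 g \<tau>) + g \<tau>) (at \<tau>)" if "bounded_cont B g" for B g
    using A that by (auto simp: solution_operator_def)
  have S2: "bounded_cont (C2 * B) (S2 g)"
    "\<And>\<tau>. (S2 g has_vector_derivative D (S2 g \<tau>) + g \<tau>) (at \<tau>)" if "bounded_cont B g" for B g
    using D that by (auto simp: solution_operator_def)
  have forcing: "bounded_cont (B + K * (C1 * B)) (\<lambda>\<sigma>. snd (g \<sigma>) + P (S1 (\<lambda>\<sigma>. fst (g \<sigma>)) \<sigma>))"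
    if "bounded_cont B g" for B and g :: "real \<Rightarrow> 'a \<times> 'b"
    by (rule bounded_cont_add[OF snd[OF that] K(2)[OF S1(1)[OF fst[OF that]]]])
  have "bounded_cont (C * B) (S g)" if "bounded_cont B g" for B and g :: "real \<Rightarrow> 'a \<times> 'b"
  proof -
    have "norm (S g \<tau>) \<le> C1 * B + C2 * (B + K * (C1 * B))" for \<tau>
      using S1(1)[OF fst[OF that]] S2(1)[OF forcing[OF that]] norm_Pair_le
      unfolding S_def bounded_cont_def
      by (meson add_mono order_trans)
    moreover have "continuous_on UNIV (S g)"
      using S1(1)[OF fst[OF that]] S2(1)[OF forcing[OF that]]
      unfolding S_def bounded_cont_def by (intro continuous_intros) auto
    ultimately show ?thesis
      by (simp add: bounded_cont_def C_def algebra_simps)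
  qed
  moreover have "(S g has_vector_derivative (A (fst (S g \<tau>)), D (snd (S g \<tau>)) + P (fst (S g \<tau>)))
      + g \<tau>) (at \<tau>)" if "bounded_cont B g" for B and g :: "real \<Rightarrow> 'a \<times> 'b" and \<tau>
  proof -
    have "(S g has_vector_derivative (A (fst (S g \<tau>)) + fst (g \<tau>),
        D (snd (S g \<tau>)) + (snd (g \<tau>) + P (fst (S g \<tau>))))) (at \<tau>)"
      unfolding S_def fst_conv snd_conv
      by (rule has_vector_derivative_Pair[OF S1(2)[OF fst[OF that]] S2(2)[OF forcing[OF that]]])
    then show ?thesis
      by (simp add: prod_eq_iff plus_prod_def algebra_simps)
  qed
  moreover have "S (\<lambda>\<sigma>. g \<sigma> - h \<sigma>) \<tau> = S g \<tau> - S h \<tau>"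
    if g: "bounded_cont B g" and h: "bounded_cont B' h"
    for B B' and g h :: "real \<Rightarrow> 'a \<times> 'b" and \<tau>
  proof -
    have 1: "S1 (\<lambda>\<sigma>. fst (g \<sigma>) - fst (h \<sigma>)) \<sigma> = S1 (\<lambda>\<sigma>. fst (g \<sigma>)) \<sigma> - S1 (\<lambda>\<sigma>. fst (h \<sigma>)) \<sigma>" for \<sigma>
      using A fst[OF g] fst[OF h] unfolding solution_operator_def by blast
    have "S2 (\<lambda>\<sigma>. snd (g \<sigma>) + P (S1 (\<lambda>\<sigma>. fst (g \<sigma>)) \<sigma>) -
          (snd (h \<sigma>) + P (S1 (\<lambda>\<sigma>. fst (h \<sigma>)) \<sigma>))) \<tau>
        = S2 (\<lambda>\<sigma>. snd (g \<sigma>) + P (S1 (\<lambda>\<sigma>. fst (g \<sigma>)) \<sigma>)) \<tau>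
          - S2 (\<lambda>\<sigma>. snd (h \<sigma>) + P (S1 (\<lambda>\<sigma>. fst (h \<sigma>)) \<sigma>)) \<tau>"
      using D forcing[OF g] forcing[OF h] unfolding solution_operator_def by blast
    then show ?thesis
      by (simp add: S_def 1 P.diff algebra_simps)
  qed
  moreover have "C > 0"
    using pos K(1) by (simp add: C_def add_pos_pos)
  ultimately have "solution_operator (\<lambda>x. (A (fst x), D (snd x) + P (fst x))) C S"
    unfolding solution_operator_def by blast
  then show ?thesis by blast
qed

text \<open>A fixed point of \<open>v \<mapsto> S (\<lambda>\<tau>. G \<tau> (v \<tau>))\<close> on
  the closed unit ball of bounded continuous functions. One \<open>\<eta>\<close> controls both size
  and Lipschitz constant of \<open>G\<close>, so \<open>C * \<eta> \<le> 1 / 2\<close> yields the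
  self-map and the contraction at once.\<close>

lemma small_bounded_solution_exists:
  assumes S: "solution_operator L C S" and small: "C * \<eta> \<le> 1 / 2"
    and cont: "continuous_on (UNIV \<times> cball 0 1) (\<lambda>(\<tau>, x). G \<tau> x)"
    and bound: "\<And>\<tau> x. norm x \<le> 1 \<Longrightarrow> norm (G \<tau> x) \<le> \<eta>"
    and lip: "\<And>\<tau> x y. norm x \<le> 1 \<Longrightarrow> norm y \<le> 1 \<Longrightarrow> norm (G \<tau> x - G \<tau> y) \<le> \<eta> * norm (x - y)"
  shows "\<exists>v. \<forall>\<tau>. norm (v \<tau>) \<le> 1 \<and> (v has_vector_derivative L (v \<tau>) + G \<tau> (v \<tau>)) (at \<tau>)"
proof -
  define N where "N = (\<lambda>v :: real \<Rightarrow>\<^sub>C 'a. \<lambda>\<tau>. G \<tau> (v \<tau>))"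
  define \<Phi> where "\<Phi> = (\<lambda>v. Bcontfun (S (N v)))"
  let ?B = "cball (0 :: real \<Rightarrow>\<^sub>C 'a) 1"
  have C: "C > 0" using S by (simp add: solution_operator_def)
  have le1: "norm (v \<tau>) \<le> 1" if "v \<in> ?B" for v \<tau>
    using that norm_bounded[of v \<tau>] by simp
  have N: "bounded_cont \<eta> (N v)" if "v \<in> ?B" for v
  proof -
    have "continuous_on UNIV (\<lambda>\<tau>. (\<lambda>(\<tau>, x). G \<tau> x) (\<tau>, v \<tau>))"
      by (rule continuous_on_compose2[OF cont]) (use le1[OF that] in \<open>auto intro!: continuous_intros\<close>)
    then show ?thesis
      using bound le1[OF that] by (simp add: bounded_cont_def N_def)
  qed
  have sol: "bounded_cont (C * B) (S g)"
    "\<And>\<tau>. (S g has_vector_derivative L (S g \<tau>) + g \<tau>) (at \<tau>)" if "bounded_cont B g" for B g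
    using S that by (auto simp: solution_operator_def)
  have \<Phi>: "apply_bcontfun (\<Phi> v) = S (N v)" if "v \<in> ?B" for v
    unfolding \<Phi>_def
    by (rule Bcontfun_inverse) (use sol(1)[OF N[OF that]] in \<open>auto intro!: bcontfun_normI simp: bounded_cont_def\<close>)
  have "\<exists>!v\<in>?B. \<Phi> v = v"
  proof (rule Banach_fix[where c = "1 / 2"])
    show "complete ?B" by (simp add: complete_eq_closed)
    show "\<Phi> ` ?B \<subseteq> ?B"
    proof clarify
      fix v assume v: "v \<in> ?B"
      have "norm (\<Phi> v) \<le> 1"
      proof (rule norm_bound)
        fix \<tau>
        have "norm (\<Phi> v \<tau>) \<le> C * \<eta>"
          using sol(1)[OF N[OF v]] unfolding \<Phi>[OF v] bounded_cont_def by blast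
        then show "norm (\<Phi> v \<tau>) \<le> 1"
          using small by linarith
      qed
      then show "\<Phi> v \<in> ?B" by simp
    qed
    show "dist (\<Phi> v) (\<Phi> w) \<le> 1 / 2 * dist v w" if v: "v \<in> ?B" and w: "w \<in> ?B" for v w
    proof -
      have "\<eta> \<ge> 0" by (rule order_trans[OF norm_ge_zero bound[of 0 0]]) simp
      have "norm (N v \<sigma> - N w \<sigma>) \<le> \<eta> * dist v w" for \<sigma>
      proof -
        have "norm (N v \<sigma> - N w \<sigma>) \<le> \<eta> * norm (v \<sigma> - w \<sigma>)"
          unfolding N_def by (rule lip[OF le1[OF v] le1[OF w]])
        also have "\<dots> \<le> \<eta> * dist v w"
          using dist_bounded[of v \<sigma> w] \<open>\<eta> \<ge> 0\<close> by (intro mult_left_mono) (auto simp: dist_norm)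
        finally show ?thesis .
      qed
      then have "bounded_cont (\<eta> * dist v w) (\<lambda>\<sigma>. N v \<sigma> - N w \<sigma>)"
        using N[OF v] N[OF w] unfolding bounded_cont_def by (auto intro!: continuous_intros)
      from sol(1)[OF this] have le: "norm (S (\<lambda>\<sigma>. N v \<sigma> - N w \<sigma>) \<tau>) \<le> C * (\<eta> * dist v w)" for \<tau>
        by (simp add: bounded_cont_def)
      have diff: "S (\<lambda>\<sigma>. N v \<sigma> - N w \<sigma>) \<tau> = S (N v) \<tau> - S (N w) \<tau>" for \<tau>
        using S N[OF v] N[OF w] unfolding solution_operator_def by blast
      have "C * (\<eta> * dist v w) \<le> 1 / 2 * dist v w"
        using mult_right_mono[OF small, of "dist v w"] by (simp add: mult.assoc)
      then have "dist (\<Phi> v \<tau>) (\<Phi> w \<tau>) \<le> 1 / 2 * dist v w" for \<tau>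
        unfolding \<Phi>[OF v] \<Phi>[OF w] dist_norm[of "S _ \<tau>"]
        by (rule order_trans[OF le[unfolded diff]])
      then show "dist (\<Phi> v) (\<Phi> w) \<le> 1 / 2 * dist v w"
        by (rule dist_bound)
    qed
  qed auto
  then obtain v where v: "v \<in> ?B" "\<Phi> v = v" by blast
  then have "S (N v) = v" using \<Phi>[OF v(1)] by simp
  then have "norm (v \<tau>) \<le> 1 \<and> (v has_vector_derivative L (v \<tau>) + G \<tau> (v \<tau>)) (at \<tau>)" for \<tau>
    using le1[OF v(1)] sol(2)[OF N[OF v(1)], of \<tau>] by (simp add: N_def)
  then show ?thesis by blast
qed

section \<open>The linearization at the burst\<close>

text \<open>All constants of the linearization lie in the field generated by \<open>J\<close>.\<close>

definition J :: complex where "J = complex_of_real (sqrt 3) * \<i>"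

text \<open>The complex growth exponent of the burst: \<open>Z(t)\<close> is sqrt (2a) times
  \<open>exp (\<kappa> * ln t)\<close>. For \<open>\<xi> > 0\<close> the imaginary part b/(2a)
  equals 5 sqrt 3 / 6, whatever \<open>\<xi>\<close> is.\<close>

definition \<kappa> :: complex where "\<kappa> = 1 / 2 + 5 / 6 * J"

lemma J_mult [simp]: "J * J = - 3" "J * (J * x) = - 3 * x"
proof -
  show "J * J = - 3"
    by (simp add: J_def complex_eq_iff)
  then show "J * (J * x) = - 3 * x"
    by (simp flip: mult.assoc)
qed

lemma cnj_J [simp]: "cnj J = - J"
  by (simp add: J_def)

lemma Re_\<kappa> [simp]: "Re \<kappa> = 1 / 2"
  by (simp add: \<kappa>_def J_def)

text \<open>The linearization in the relative coordinates \<open>p = y\<^sub>1 - y\<^sub>3\<close>, \<open>r = y\<^sub>2 - y\<^sub>3\<close>, which decouple from \<open>y\<^sub>3\<close>.\<close>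

definition rel_lin :: "complex \<times> complex \<Rightarrow> complex \<times> complex" where
  "rel_lin x = (case x of (p, r) \<Rightarrow>
     ((- 4 + 33 * J) / 21 * cnj p - (7 + 21 * J) / 12 * cnj r - \<kappa> * p,
      (4 + 16 * J) / 21 * cnj p - (7 + 7 * J) / 6 * cnj r - \<kappa> * r))"

text \<open>By \<open>rel_lin_quadratic\<close>, \<^term>\<open>\<lambda>x. rel_lin (rel_lin x) + rel_lin x\<close> is complex linear with a nilpotent
  matrix, so the only eigenvalues of \<^const>\<open>rel_lin\<close> are \<open>0\<close> and \<open>-1\<close>.\<close>

lemma rel_lin_quadratic:
  "rel_lin (rel_lin (p, r)) + rel_lin (p, r) =
     ((1 + J / 9) * p + (- 4 / 3 + J / 9) * r, (2 / 3 + 2 * J / 9) * p - (1 + J / 9) * r)"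
  by (simp add: rel_lin_def \<kappa>_def field_simps)


lemma bounded_linear_rel_lin: "bounded_linear rel_lin"
proof -
  have eq: "rel_lin = (\<lambda>x. ((- 4 + 33 * J) / 21 * cnj (fst x) - (7 + 21 * J) / 12 * cnj (snd x) - \<kappa> * fst x,
      (4 + 16 * J) / 21 * cnj (fst x) - (7 + 7 * J) / 6 * cnj (snd x) - \<kappa> * snd x))"
    by (auto simp: rel_lin_def)
  show ?thesis
    unfolding eq
    by (intro bounded_linear_Pair bounded_linear_sub bounded_linear_add bounded_linear_const_mult
        bounded_linear_compose[OF bounded_linear_cnj] bounded_linear_fst bounded_linear_snd)
qed

text \<open>With N for \<open>rel_lin\<close> squared plus \<open>rel_lin\<close>, the product is N
  composed with itself, and N squares to 0. Since N itself is not 0, both roots occur twice; 0 and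
  -1 appear lowered by 1/4.\<close>

lemma rel_lin_annihilator:
  "shift_prod (\<lambda>x. rel_lin x - (1 / 4) *\<^sub>R x) [- 1 / 4, - 5 / 4, - 1 / 4, - 5 / 4] x = 0"
proof -
  have step: "rel_lin y - (1 / 4) *\<^sub>R y - (- 1 / 4) *\<^sub>R y = rel_lin y"
    "rel_lin y - (1 / 4) *\<^sub>R y - (- 5 / 4) *\<^sub>R y = rel_lin y + y" for y
    using scaleR_add_left[of 1 "1 / 4" y] by (simp_all add: algebra_simps)
  obtain p r where x: "x = (p, r)" by fastforce
  have "shift_prod (\<lambda>x. rel_lin x - (1 / 4) *\<^sub>R x) [- 1 / 4, - 5 / 4, - 1 / 4, - 5 / 4] x
      = rel_lin (rel_lin (rel_lin (rel_lin x) + rel_lin x)) + rel_lin (rel_lin (rel_lin x) + rel_lin x)"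
    by (simp only: shift_prod.simps step)
  also have "\<dots> = 0"
    unfolding x rel_lin_quadratic by (simp add: field_simps zero_prod_def)
  finally show ?thesis .
qed

text \<open>The interaction depends on differences only, so the third vortex feels \<open>p\<close>
  and \<open>r\<close> through this map and its own displacement only through
  \<open>- \<kappa>\<close>. This is what makes the full linear part triangular.\<close>

definition third_lin :: "complex \<times> complex \<Rightarrow> complex" where
  "third_lin x = (case x of (p, r) \<Rightarrow> (- 12 + J) / 63 * cnj p + (21 + 7 * J) / 36 * cnj r)"

lemma bounded_linear_third_lin: "bounded_linear third_lin"
proof -
  have eq: "third_lin = (\<lambda>x. (- 12 + J) / 63 * cnj (fst x) + (21 + 7 * J) / 36 * cnj (snd x))"
    by (auto simp: third_lin_def)
  show ?thesis
    unfolding eq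
    by (intro bounded_linear_add bounded_linear_const_mult
        bounded_linear_compose[OF bounded_linear_cnj] bounded_linear_fst bounded_linear_snd)
qed

definition profile_lin :: "(complex \<times> complex) \<times> complex \<Rightarrow> (complex \<times> complex) \<times> complex" where
  "profile_lin x = (rel_lin (fst x) - (1 / 4) *\<^sub>R fst x,
     - (\<kappa> + 1 / 4) * snd x + third_lin (fst x))"

lemma bounded_linear_profile_lin: "bounded_linear profile_lin"
  unfolding profile_lin_def
  by (intro bounded_linear_Pair bounded_linear_sub bounded_linear_add bounded_linear_const_mult
      bounded_linear_compose[OF bounded_linear_rel_lin]
      bounded_linear_compose[OF bounded_linear_third_lin]
      bounded_linear_const_scaleR bounded_linear_fst bounded_linear_snd)

lemma profile_solution_operator: "\<exists>C S. solution_operator profile_lin C S"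
proof -
  have L: "bounded_linear (\<lambda>x. rel_lin x - (1 / 4) *\<^sub>R x)"
    by (rule bounded_linear_shift[OF bounded_linear_rel_lin])
  obtain C1 S1 where "solution_operator (\<lambda>x. rel_lin x - (1 / 4) *\<^sub>R x) C1 S1"
    using solution_operator_of_annihilator[OF L _ rel_lin_annihilator] by auto
  moreover obtain C2 S2 where "solution_operator (\<lambda>x. - (\<kappa> + 1 / 4) * x) C2 S2"
    using solution_operator_complex_scalar[of "\<kappa> + 1 / 4"] by auto
  ultimately show ?thesis
    unfolding profile_lin_def
    by (rule solution_operator_triangular[OF _ _ bounded_linear_third_lin])
qed

section \<open>The nonlinear perturbed profile\<close>

text \<open>The second-order Taylor remainder of \<open>1 / (A + \<epsilon> h)\<close> divided by
  \<open>\<epsilon>\<close>. The perturbation is itself scaled by \<open>\<epsilon>\<close>, so the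
  equation for the rescaled unknown keeps one power of \<open>\<epsilon>\<close> as
  smallness.\<close>

definition remainder :: "complex \<Rightarrow> real \<Rightarrow> complex \<Rightarrow> complex" where
  "remainder A \<epsilon> h = \<epsilon> * h\<^sup>2 / (A\<^sup>2 * (A + \<epsilon> * h))"

lemma inverse_expansion:
  assumes "A \<noteq> 0" "A + of_real \<epsilon> * h \<noteq> 0"
  shows "1 / (A + of_real \<epsilon> * h) = 1 / A - of_real \<epsilon> * h / A\<^sup>2 + of_real \<epsilon> * remainder A \<epsilon> h"
  using assms unfolding remainder_def
  by (simp add: divide_simps) (simp add: power2_eq_square algebra_simps)

text \<open>The caps 2 and 1/4 limit the displacement to 1/2, half of the smallest admissible gap.
  The same caps later keep the vortices apart.\<close>

lemma norm_perturbed_ge: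
  fixes A h :: complex
  assumes "norm A \<ge> 1" "norm h \<le> 2" "0 \<le> \<epsilon>" "\<epsilon> \<le> 1 / 4"
  shows "norm (A + of_real \<epsilon> * h) \<ge> norm A / 2"
proof -
  have "norm (of_real \<epsilon> * h) \<le> 1 / 4 * 2"
    unfolding norm_mult using assms by (intro mult_mono) auto
  then show ?thesis
    using norm_diff_ineq[of A "of_real \<epsilon> * h"] assms(1) by simp
qed

lemma perturbed_nonzero:
  fixes A h :: complex
  assumes "norm A \<ge> 1" "norm h \<le> 2" "0 \<le> \<epsilon>" "\<epsilon> \<le> 1 / 4"
  shows "A + of_real \<epsilon> * h \<noteq> 0"
  using norm_perturbed_ge[OF assms] assms(1) by auto

text \<open>The factor \<open>h - k\<close> splits off the difference explicitly. What is left has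
  numerator at most 4|A| + 1, hence at most 5|A|, and denominator at least |A|^4 / 4, hence at least
  |A| / 4; the quotient is 20.\<close>

lemma remainder_lipschitz:
  assumes A: "norm A \<ge> 1" and h: "norm h \<le> 2" and k: "norm k \<le> 2" and \<epsilon>: "0 \<le> \<epsilon>" "\<epsilon> \<le> 1 / 4"
  shows "norm (remainder A \<epsilon> h - remainder A \<epsilon> k) \<le> 20 * \<epsilon> * norm (h - k)"
proof -
  let ?a = "norm A"
  let ?h = "A + of_real \<epsilon> * h" and ?k = "A + of_real \<epsilon> * k"
  have nz: "A \<noteq> 0" "?h \<noteq> 0" "?k \<noteq> 0"
    using A perturbed_nonzero[OF A h \<epsilon>] perturbed_nonzero[OF A k \<epsilon>] by auto
  have eq: "remainder A \<epsilon> h - remainder A \<epsilon> k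
      = of_real \<epsilon> * (h - k) * ((A * (h + k) + of_real \<epsilon> * (h * k)) / (A\<^sup>2 * ?h * ?k))"
    using nz unfolding remainder_def
    by (simp add: divide_simps) (simp add: power2_eq_square algebra_simps)
  have "norm (A * (h + k) + of_real \<epsilon> * (h * k)) \<le> ?a * 4 + 1 / 4 * (2 * 2)"
  proof (rule norm_triangle_mono)
    show "norm (A * (h + k)) \<le> ?a * 4"
      unfolding norm_mult using h k by (intro mult_left_mono norm_triangle_le) auto
    show "norm (of_real \<epsilon> * (h * k)) \<le> 1 / 4 * (2 * 2)"
      unfolding norm_mult using h k \<epsilon> by (intro mult_mono) auto
  qed
  also have "\<dots> \<le> 5 * ?a" using A by simp
  finally have num: "norm (A * (h + k) + of_real \<epsilon> * (h * k)) \<le> 5 * ?a" .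
  have "?a\<^sup>2 * (?a / 2) * (?a / 2) \<le> norm (A\<^sup>2 * ?h * ?k)"
    unfolding norm_mult norm_power
    using norm_perturbed_ge[OF A h \<epsilon>] norm_perturbed_ge[OF A k \<epsilon>] by (intro mult_mono) auto
  moreover have "?a / 4 \<le> ?a\<^sup>2 * (?a / 2) * (?a / 2)"
    using power_increasing[of 1 4 ?a] A by (simp add: power2_eq_square power4_eq_xxxx)
  ultimately have den: "?a / 4 \<le> norm (A\<^sup>2 * ?h * ?k)" by linarith
  have "norm ((A * (h + k) + of_real \<epsilon> * (h * k)) / (A\<^sup>2 * ?h * ?k)) \<le> 5 * ?a / (?a / 4)"
    unfolding norm_divide using num den A by (intro frac_le) auto
  also have "\<dots> = 20" using nz by simp
  finally have "norm (of_real \<epsilon> * (h - k)) * norm ((A * (h + k) + of_real \<epsilon> * (h * k)) / (A\<^sup>2 * ?h * ?k))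
      \<le> (\<epsilon> * norm (h - k)) * 20"
    using \<epsilon> by (intro mult_mono) (auto simp: norm_mult)
  then show ?thesis
    unfolding eq norm_mult[of "of_real \<epsilon> * (h - k)"] by (simp add: algebra_simps)
qed

text \<open>The hypothesis of the contraction argument for one fixed time. It is stable under sums,
  conjugation and pairing, so the constants of the nonlinearity can be assembled by
  addition.\<close>

definition small_map :: "real \<Rightarrow> ('v::real_normed_vector \<Rightarrow> 'w::real_normed_vector) \<Rightarrow> bool" where
  "small_map \<eta> g \<longleftrightarrow> (\<forall>x\<in>cball 0 1. norm (g x) \<le> \<eta>) \<and>
     (\<forall>x\<in>cball 0 1. \<forall>y\<in>cball 0 1. norm (g x - g y) \<le> \<eta> * norm (x - y))"

lemma small_map_mono: "small_map \<eta> g \<Longrightarrow> \<eta> \<le> \<eta>' \<Longrightarrow> small_map \<eta>' g"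
  unfolding small_map_def by (meson mult_right_mono norm_ge_zero order_trans)

lemma small_map_add:
  assumes "small_map \<eta> g" "small_map \<eta>' h"
  shows "small_map (\<eta> + \<eta>') (\<lambda>x. g x + h x)"
proof -
  have "norm (g x + h x - (g y + h y)) \<le> norm (g x - g y) + norm (h x - h y)" for x y
    by (metis add_diff_add norm_triangle_ineq)
  then show ?thesis
    using assms unfolding small_map_def
    by (smt (verit) distrib_right norm_triangle_ineq)
qed

lemma small_map_cmult:
  fixes g :: "'v::real_normed_vector \<Rightarrow> 'w::real_normed_field"
  assumes "small_map \<eta> g"
  shows "small_map (norm c * \<eta>) (\<lambda>x. c * g x)"
  using assms unfolding small_map_def
  by (auto simp: norm_mult mult.assoc intro!: mult_left_mono simp flip: right_diff_distrib)

lemma small_map_uminus: "small_map \<eta> g \<Longrightarrow> small_map \<eta> (\<lambda>x. - g x)"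
  unfolding small_map_def by (simp add: norm_minus_commute)

lemma small_map_diff:
  "small_map \<eta> g \<Longrightarrow> small_map \<eta>' h \<Longrightarrow> small_map (\<eta> + \<eta>') (\<lambda>x. g x - h x)"
  using small_map_add[OF _ small_map_uminus, of \<eta> g \<eta>' h] by simp

lemma small_map_cnj: "small_map \<eta> g \<Longrightarrow> small_map \<eta> (\<lambda>x. cnj (g x))"
  unfolding small_map_def by (simp flip: complex_cnj_diff)

lemma small_map_Pair:
  assumes "small_map \<eta> g" "small_map \<eta>' h"
  shows "small_map (\<eta> + \<eta>') (\<lambda>x. (g x, h x))"
proof -
  have "norm (g x, h x) \<le> norm (g x) + norm (h x)" for x
    by (rule norm_Pair_le)
  moreover have "norm ((g x, h x) - (g y, h y)) \<le> norm (g x - g y) + norm (h x - h y)" for x y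
    using norm_Pair_le[of "g x - g y" "h x - h y"] by simp
  ultimately show ?thesis
    using assms unfolding small_map_def by (smt (verit) distrib_right)
qed

text \<open>The constant is 20 times the bound 2 for \<open>l\<close>. Since the remainder vanishes
  at 0, comparison with 0 turns the Lipschitz estimate into the size estimate.\<close>

lemma small_map_remainder:
  assumes A: "norm A \<ge> 1" and \<epsilon>: "0 \<le> \<epsilon>" "\<epsilon> \<le> 1 / 4"
    and l: "bounded_linear l" "\<And>x. norm (l x) \<le> 2 * norm x"
  shows "small_map (40 * \<epsilon>) (\<lambda>x. remainder A \<epsilon> (l x))"
proof -
  interpret l: bounded_linear l by fact
  have le2: "norm (l x) \<le> 2" if "norm x \<le> 1" for x
    using l(2)[of x] that by linarith
  have lip: "norm (remainder A \<epsilon> (l x) - remainder A \<epsilon> (l y)) \<le> 40 * \<epsilon> * norm (x - y)"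
    if "norm x \<le> 1" "norm y \<le> 1" for x y
  proof -
    have "norm (remainder A \<epsilon> (l x) - remainder A \<epsilon> (l y)) \<le> 20 * \<epsilon> * norm (l x - l y)"
      by (rule remainder_lipschitz[OF A le2[OF that(1)] le2[OF that(2)] \<epsilon>])
    also have "\<dots> \<le> 20 * \<epsilon> * (2 * norm (x - y))"
      using l(2)[of "x - y"] \<epsilon> by (intro mult_left_mono) (auto simp: l.diff)
    finally show ?thesis by simp
  qed
  moreover have "norm (remainder A \<epsilon> (l x)) \<le> 40 * \<epsilon>" if "norm x \<le> 1" for x
  proof -
    have "norm (remainder A \<epsilon> (l x)) \<le> 40 * \<epsilon> * norm x"
      using lip[OF that, of 0] by (simp add: l.zero remainder_def)
    also have "\<dots> \<le> 40 * \<epsilon> * 1"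
      using that \<epsilon> by (intro mult_left_mono) auto
    finally show ?thesis by simp
  qed
  ultimately show ?thesis
    by (simp add: small_map_def)
qed

section \<open>Expansion of the vortex interaction around the burst coefficients\<close>

lemma circ_simps [simp]:
  "circ \<xi> $ 1 = - \<xi> / 3" "circ \<xi> $ 2 = 2 * \<xi> / 3" "circ \<xi> $ 3 = 2 * \<xi> / 3"
  by (simp_all add: circ_def)

lemma burst_coeff_simps [simp]:
  "burst_coeff 1 $ 1 = - 2 + 2 * J" "burst_coeff 1 $ 2 = - 2 + J" "burst_coeff 1 $ 3 = 1"
  by (simp_all add: burst_coeff_def J_def)

lemma UNIV_3_minus:
  "UNIV - {1 :: 3} = {2, 3}" "UNIV - {2 :: 3} = {1, 3}" "UNIV - {3 :: 3} = {1, 2}"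
  unfolding UNIV_3 by auto

text \<open>Because \<open>J * J = - 3\<close>, reciprocals stay in the field generated by
  \<open>J\<close>. Writing them out removes all divisions by gaps, so the linearization reduces to
  polynomial identities in \<open>J\<close>.\<close>

lemma inverse_gaps:
  "inverse (burst_coeff 1 $ 1 - burst_coeff 1 $ 2) = - J / 3"
  "inverse (burst_coeff 1 $ 2 - burst_coeff 1 $ 1) = J / 3"
  "inverse (burst_coeff 1 $ 1 - burst_coeff 1 $ 3) = (- 3 - 2 * J) / 21"
  "inverse (burst_coeff 1 $ 3 - burst_coeff 1 $ 1) = (3 + 2 * J) / 21"
  "inverse (burst_coeff 1 $ 2 - burst_coeff 1 $ 3) = (- 3 - J) / 12"
  "inverse (burst_coeff 1 $ 3 - burst_coeff 1 $ 2) = (3 + J) / 12"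
  by (rule inverse_unique, simp add: algebra_simps)+

text \<open>Recovers \<open>(v\<^sub>1, v\<^sub>2, v\<^sub>3)\<close> from \<open>((v\<^sub>1 - v\<^sub>3, v\<^sub>2 - v\<^sub>3), v\<^sub>3)\<close>.\<close>

definition coords :: "(complex \<times> complex) \<times> complex \<Rightarrow> complex ^ 3" where
  "coords x = vector [fst (fst x) + snd x, snd (fst x) + snd x, snd x]"

lemma coords_simps [simp]:
  "coords x $ 1 = fst (fst x) + snd x" "coords x $ 2 = snd (fst x) + snd x" "coords x $ 3 = snd x"
  by (simp_all add: coords_def)

lemma bounded_linear_coords: "bounded_linear (\<lambda>x. coords x $ j)"
proof -
  have "\<forall>j. bounded_linear (\<lambda>x. coords x $ j)"
    unfolding forall_3 coords_simps
    by (intro conjI bounded_linear_add bounded_linear_snd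
        bounded_linear_compose[OF bounded_linear_fst bounded_linear_fst]
        bounded_linear_compose[OF bounded_linear_snd bounded_linear_fst])
  then show ?thesis by blast
qed

lemma norm_components_le:
  fixes x :: "(complex \<times> complex) \<times> complex"
  shows "norm (fst (fst x)) \<le> norm x" "norm (snd (fst x)) \<le> norm x" "norm (snd x) \<le> norm x"
  using norm_fst_le[of "fst (fst x)" "snd (fst x)"] norm_snd_le[of "snd (fst x)" "fst (fst x)"]
    norm_fst_le[of "fst x" "snd x"] norm_snd_le[of "snd x" "fst x"]
  by auto

lemma norm_coords_le: "norm (coords x $ j) \<le> 2 * norm x"
proof -
  have "\<forall>j. norm (coords x $ j) \<le> 2 * norm x"
    unfolding forall_3 coords_simps using norm_components_le[of x]
    by (smt (verit) norm_triangle_ineq norm_ge_zero)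
  then show ?thesis by blast
qed

lemma norm_coords_diff_le: "norm (coords x $ j - coords x $ k) \<le> 2 * norm x"
proof -
  have "\<forall>j k. norm (coords x $ j - coords x $ k) \<le> 2 * norm x"
    unfolding forall_3 coords_simps using norm_components_le[of x]
      norm_triangle_ineq4[of "fst (fst x)" "snd (fst x)"]
    by (simp add: norm_minus_commute) (smt (verit) norm_ge_zero)
  then show ?thesis by blast
qed

lemma norm_gap_ge:
  assumes "j \<noteq> k"
  shows "norm (burst_coeff 1 $ j - burst_coeff 1 $ k) \<ge> 1"
proof -
  have J: "norm J \<ge> 1" by (simp add: J_def norm_mult)
  have "Re J = 0" by (simp add: J_def)
  then have "norm (2 * J - 3) \<ge> 1" "norm (J - 3) \<ge> 1"
    using abs_Re_le_cmod[of "2 * J - 3"] abs_Re_le_cmod[of "J - 3"] by simp_all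
  moreover have "burst_coeff 1 $ 1 - burst_coeff 1 $ 2 = J"
    "burst_coeff 1 $ 1 - burst_coeff 1 $ 3 = 2 * J - 3"
    "burst_coeff 1 $ 2 - burst_coeff 1 $ 3 = J - 3"
    by simp_all
  ultimately have "norm (burst_coeff 1 $ 1 - burst_coeff 1 $ 2) \<ge> 1"
    "norm (burst_coeff 1 $ 1 - burst_coeff 1 $ 3) \<ge> 1"
    "norm (burst_coeff 1 $ 2 - burst_coeff 1 $ 3) \<ge> 1"
    using J by presburger+
  then have "\<forall>j k. j \<noteq> k \<longrightarrow> norm (burst_coeff 1 $ j - burst_coeff 1 $ k) \<ge> 1"
    unfolding forall_3 by (metis norm_minus_commute)
  then show ?thesis using assms by blast
qed

text \<open>The factor \<open>7 * J\<close> is \<open>\<i> * \<xi> / (4 * pi * a)\<close> for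
  \<open>\<xi> > 0\<close>: passing to \<open>ln t\<close> and dividing by \<open>Z\<close>
  multiplies the interaction by t/|Z|^2 = 1/(2a), and the conjugate of
  \<open>1 / (2 * pi * \<i>)\<close> contributes the rest.\<close>

definition nonlinearity :: "3 \<Rightarrow> real \<Rightarrow> (complex \<times> complex) \<times> complex \<Rightarrow> complex" where
  "nonlinearity j \<epsilon> x = 7 * J * cnj (\<Sum>k\<in>UNIV - {j}. complex_of_real (circ 1 $ k) *
     remainder (burst_coeff 1 $ j - burst_coeff 1 $ k) \<epsilon> (coords x $ j - coords x $ k))"

text \<open>Order zero is the algebraic identity that defines the burst, order one is the
  linearization, and the rest is \<open>nonlinearity\<close>. The term
  \<open>\<kappa> + 1 / 4\<close> undoes the damping already built into
  \<open>profile_lin\<close>.\<close>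

lemma vortex_expansion:
  assumes "0 \<le> \<epsilon>" "\<epsilon> \<le> 1 / 4" "norm x \<le> 1"
  defines "U \<equiv> \<lambda>j. burst_coeff 1 $ j + of_real \<epsilon> * coords x $ j"
  shows "7 * J * cnj (\<Sum>k\<in>UNIV - {j}. complex_of_real (circ 1 $ k) / (U j - U k)) =
    \<kappa> * burst_coeff 1 $ j +
    of_real \<epsilon> * (coords (profile_lin x) $ j + (\<kappa> + 1 / 4) * coords x $ j + nonlinearity j \<epsilon> x)"
proof -
  have "complex_of_real (circ 1 $ k) / (U j - U k) =
      complex_of_real (circ 1 $ k) * (inverse (burst_coeff 1 $ j - burst_coeff 1 $ k)
      - of_real \<epsilon> * (coords x $ j - coords x $ k) * (inverse (burst_coeff 1 $ j - burst_coeff 1 $ k))\<^sup>2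
      + of_real \<epsilon> * remainder (burst_coeff 1 $ j - burst_coeff 1 $ k) \<epsilon> (coords x $ j - coords x $ k))"
    if "j \<noteq> k" for j k
  proof -
    let ?A = "burst_coeff 1 $ j - burst_coeff 1 $ k" and ?h = "coords x $ j - coords x $ k"
    have A: "norm ?A \<ge> 1" by (rule norm_gap_ge[OF that])
    have h: "norm ?h \<le> 2" using norm_coords_diff_le[of x j k] assms(3) by linarith
    have "U j - U k = ?A + of_real \<epsilon> * ?h"
      by (simp add: U_def algebra_simps)
    moreover have "?A \<noteq> 0" using A by auto
    ultimately show ?thesis
      using inverse_expansion[OF _ perturbed_nonzero[OF A h assms(1,2)]]
      by (simp add: divide_inverse power_inverse)
  qed
  then have "(\<Sum>k\<in>UNIV - {j}. complex_of_real (circ 1 $ k) / (U j - U k)) =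
      (\<Sum>k\<in>UNIV - {j}. complex_of_real (circ 1 $ k) * (inverse (burst_coeff 1 $ j - burst_coeff 1 $ k)
      - of_real \<epsilon> * (coords x $ j - coords x $ k) * (inverse (burst_coeff 1 $ j - burst_coeff 1 $ k))\<^sup>2
      + of_real \<epsilon> * remainder (burst_coeff 1 $ j - burst_coeff 1 $ k) \<epsilon> (coords x $ j - coords x $ k)))"
    for j
    by (intro sum.cong) auto
  note eq = this
  obtain p r s where x: "x = ((p, r), s)" by (metis surj_pair)
  have "\<forall>j. 7 * J * cnj (\<Sum>k\<in>UNIV - {j}. complex_of_real (circ 1 $ k) / (U j - U k)) =
    \<kappa> * burst_coeff 1 $ j +
    of_real \<epsilon> * (coords (profile_lin x) $ j + (\<kappa> + 1 / 4) * coords x $ j + nonlinearity j \<epsilon> x)"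
    unfolding eq nonlinearity_def forall_3 UNIV_3_minus
    \<comment> \<open>\<open>burst_coeff_simps\<close> is withheld so that the gaps still match
      \<open>inverse_gaps\<close>. The second call compares coefficients in \<open>J\<close>,
      verifying both the burst identity and the numbers fixed in \<open>rel_lin\<close> and
      \<open>third_lin\<close>.\<close>
    by (simp add: inverse_gaps del: burst_coeff_simps)
      (simp add: x power2_eq_square profile_lin_def rel_lin_def third_lin_def \<kappa>_def
        scaleR_conv_of_real field_simps)
  then show ?thesis by blast
qed

text \<open>Two summands of size \<open>40 * \<epsilon>\<close>, since the circulations are at most
  1 in modulus, times |7J| = 7 sqrt 3 \<le> 13, give 1040.\<close>

lemma small_map_nonlinearity:
  assumes "0 \<le> \<epsilon>" "\<epsilon> \<le> 1 / 4"
  shows "small_map (1040 * \<epsilon>) (nonlinearity j \<epsilon>)"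
proof -
  have summand: "small_map (40 * \<epsilon>) (\<lambda>x. complex_of_real (circ 1 $ k) *
      remainder (burst_coeff 1 $ j - burst_coeff 1 $ k) \<epsilon> (coords x $ j - coords x $ k))"
    if "j \<noteq> k" for j k
  proof (rule small_map_mono)
    show "small_map (norm (complex_of_real (circ 1 $ k)) * (40 * \<epsilon>)) (\<lambda>x. complex_of_real (circ 1 $ k) *
      remainder (burst_coeff 1 $ j - burst_coeff 1 $ k) \<epsilon> (coords x $ j - coords x $ k))"
      by (intro small_map_cmult small_map_remainder norm_gap_ge that assms
          bounded_linear_sub bounded_linear_coords norm_coords_diff_le)
    have "\<forall>k. norm (complex_of_real (circ 1 $ k)) \<le> 1"
      unfolding forall_3 by simp
    then show "norm (complex_of_real (circ 1 $ k)) * (40 * \<epsilon>) \<le> 40 * \<epsilon>"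
      using mult_right_mono[of "norm (complex_of_real (circ 1 $ k))" 1 "40 * \<epsilon>"] assms(1) by simp
  qed
  have "\<forall>j. small_map (40 * \<epsilon> + 40 * \<epsilon>) (\<lambda>x. \<Sum>k\<in>UNIV - {j}. complex_of_real (circ 1 $ k) *
      remainder (burst_coeff 1 $ j - burst_coeff 1 $ k) \<epsilon> (coords x $ j - coords x $ k))"
    unfolding forall_3 UNIV_3_minus
    using small_map_add[OF summand summand]
    by (simp del: circ_simps burst_coeff_simps coords_simps)
  then have "small_map (norm (7 * J) * (40 * \<epsilon> + 40 * \<epsilon>)) (nonlinearity j \<epsilon>)"
    unfolding nonlinearity_def[abs_def] by (intro small_map_cmult small_map_cnj) blast
  moreover have "norm (7 * J) * (40 * \<epsilon> + 40 * \<epsilon>) \<le> 13 * (40 * \<epsilon> + 40 * \<epsilon>)"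
  proof (rule mult_right_mono)
    have "sqrt 3 \<le> 13 / 7"
      by (rule real_le_lsqrt) (auto simp: power2_eq_square)
    then show "norm (7 * J) \<le> 13" by (simp add: J_def norm_mult)
  qed (use assms in simp)
  ultimately show ?thesis
    by (rule small_map_mono[OF _ order_trans]) simp
qed

lemma continuous_on_nonlinearity:
  fixes \<epsilon> :: "real \<Rightarrow> real"
  assumes "continuous_on UNIV \<epsilon>" "\<And>\<tau>. 0 \<le> \<epsilon> \<tau>" "\<And>\<tau>. \<epsilon> \<tau> \<le> 1 / 4"
  shows "continuous_on (UNIV \<times> cball 0 1) (\<lambda>(\<tau>, x). nonlinearity j (\<epsilon> \<tau>) x)"
proof -
  let ?X = "UNIV \<times> cball 0 1 :: (real \<times> (complex \<times> complex) \<times> complex) set"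
  have c: "continuous_on ?X (\<lambda>z. coords (snd z) $ i)" for i
    by (intro bounded_linear.continuous_on[OF bounded_linear_coords] continuous_intros)
  have e: "continuous_on ?X (\<lambda>z. \<epsilon> (fst z))"
    by (rule continuous_on_compose2[OF assms(1)]) (auto intro!: continuous_intros)
  have "continuous_on ?X (\<lambda>z. remainder (burst_coeff 1 $ j - burst_coeff 1 $ k) (\<epsilon> (fst z))
      (coords (snd z) $ j - coords (snd z) $ k))" if "k \<in> UNIV - {j}" for k
  proof -
    let ?A = "burst_coeff 1 $ j - burst_coeff 1 $ k"
    define h where "h = (\<lambda>z :: real \<times> (complex \<times> complex) \<times> complex. coords (snd z) $ j - coords (snd z) $ k)"
    have ch: "continuous_on ?X h"
      unfolding h_def by (rule continuous_on_diff[OF c c])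
    have A: "norm ?A \<ge> 1" by (rule norm_gap_ge) (use that in auto)
    have "?A\<^sup>2 * (?A + of_real (\<epsilon> (fst z)) * h z) \<noteq> 0" if "z \<in> ?X" for z
    proof -
      have "norm (h z) \<le> 2"
        unfolding h_def using norm_coords_diff_le[of "snd z" j k] that by (cases z) auto
      then show ?thesis
        using perturbed_nonzero[OF A _ assms(2,3)] A by auto
    qed
    then have "continuous_on ?X (\<lambda>z. remainder ?A (\<epsilon> (fst z)) (h z))"
      unfolding remainder_def by (intro continuous_intros ch e) auto
    then show ?thesis by (simp add: h_def)
  qed
  then show ?thesis
    unfolding nonlinearity_def case_prod_beta by (intro continuous_intros) auto
qed

text \<open>\<open>\<epsilon>\<^sub>0\<close> and \<open>K\<close> are fixed before the force and
  the time horizon, which makes the existence time uniform over forces. \<open>D\<close> is exposed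
  because the later estimate of the perturbation needs its derivative as well as its size.\<close>

lemma perturbed_profile_exists:
  "\<exists>\<epsilon>\<^sub>0 K. 0 < \<epsilon>\<^sub>0 \<and> \<epsilon>\<^sub>0 \<le> 1 / 4 \<and> (\<forall>F \<tau>\<^sub>0. exp (\<tau>\<^sub>0 / 4) \<le> \<epsilon>\<^sub>0 \<longrightarrow>
     (\<forall>j. continuous_on UNIV (\<lambda>(\<tau>, w). F j \<tau> w)) \<longrightarrow>
     (\<forall>j \<tau> w. norm (F j \<tau> w) \<le> \<epsilon>\<^sub>0) \<longrightarrow>
     (\<forall>j \<tau> w w'. norm (F j \<tau> w - F j \<tau> w') \<le> \<epsilon>\<^sub>0 * norm (w - w')) \<longrightarrow>
     (\<exists>v :: real \<Rightarrow> complex ^ 3. \<forall>\<tau>\<le>\<tau>\<^sub>0. \<forall>j. \<exists>D.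
        (\<forall>k. norm (v \<tau> $ j - v \<tau> $ k) \<le> 2) \<and>
        norm (v \<tau> $ j) \<le> 2 \<and> norm D \<le> K * exp (\<tau> / 4) \<and>
        D = 7 * J * cnj (\<Sum>k\<in>UNIV - {j}. complex_of_real (circ 1 $ k) /
              (burst_coeff 1 $ j + complex_of_real (exp (\<tau> / 4)) * v \<tau> $ j - (burst_coeff 1 $ k + complex_of_real (exp (\<tau> / 4)) * v \<tau> $ k)))
            - \<kappa> * (burst_coeff 1 $ j + complex_of_real (exp (\<tau> / 4)) * v \<tau> $ j) + complex_of_real (exp (\<tau> / 4)) * F j \<tau> (v \<tau> $ j) \<and>
        ((\<lambda>\<sigma>. complex_of_real (exp (\<sigma> / 4)) * v \<sigma> $ j) has_vector_derivative D) (at \<tau>)))"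
proof -
  obtain C S where S: "solution_operator profile_lin C S"
    using profile_solution_operator by blast
  then have "C > 0" by (simp add: solution_operator_def)
  obtain K where K: "K > 0" "\<And>x. norm (profile_lin x) \<le> norm x * K"
    using bounded_linear.pos_bounded[OF bounded_linear_profile_lin] by blast
  \<comment> \<open>1/4 is the cap of the gap estimates; \<open>1 / (20000 * C)\<close> gives
    \<open>C * \<eta> \<le> 1 / 2\<close> for \<open>\<eta> = 10000 * \<epsilon>\<^sub>0\<close>, a
    rounding up of the factor 5210 found below.\<close>
  define \<epsilon>\<^sub>0 where "\<epsilon>\<^sub>0 = min (1 / 4) (1 / (20000 * C))"
  define \<eta> where "\<eta> = 10000 * \<epsilon>\<^sub>0"
  have \<epsilon>\<^sub>0: "0 < \<epsilon>\<^sub>0" "\<epsilon>\<^sub>0 \<le> 1 / 4" "\<eta> > 0"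
    using \<open>C > 0\<close> by (auto simp: \<epsilon>\<^sub>0_def \<eta>_def)
  have "C * \<epsilon>\<^sub>0 \<le> C * (1 / (20000 * C))"
    using \<open>C > 0\<close> by (intro mult_left_mono) (auto simp: \<epsilon>\<^sub>0_def)
  then have small: "C * \<eta> \<le> 1 / 2"
    using \<open>C > 0\<close> by (simp add: \<eta>_def)
  have "\<exists>v :: real \<Rightarrow> complex ^ 3. \<forall>\<tau>\<le>\<tau>\<^sub>0. \<forall>j. \<exists>D.
        (\<forall>k. norm (v \<tau> $ j - v \<tau> $ k) \<le> 2) \<and>
        norm (v \<tau> $ j) \<le> 2 \<and> norm D \<le> (2 * (K + \<eta>) + 1 / 2) * exp (\<tau> / 4) \<and>
        D = 7 * J * cnj (\<Sum>k\<in>UNIV - {j}. complex_of_real (circ 1 $ k) /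
              (burst_coeff 1 $ j + complex_of_real (exp (\<tau> / 4)) * v \<tau> $ j - (burst_coeff 1 $ k + complex_of_real (exp (\<tau> / 4)) * v \<tau> $ k)))
            - \<kappa> * (burst_coeff 1 $ j + complex_of_real (exp (\<tau> / 4)) * v \<tau> $ j) + complex_of_real (exp (\<tau> / 4)) * F j \<tau> (v \<tau> $ j) \<and>
        ((\<lambda>\<sigma>. complex_of_real (exp (\<sigma> / 4)) * v \<sigma> $ j) has_vector_derivative D) (at \<tau>)"
    if \<tau>\<^sub>0: "exp (\<tau>\<^sub>0 / 4) \<le> \<epsilon>\<^sub>0" and F_cont: "\<And>j. continuous_on UNIV (\<lambda>(\<tau>, w). F j \<tau> w)"
      and F_bound: "\<And>j \<tau> w. norm (F j \<tau> w) \<le> \<epsilon>\<^sub>0"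
      and F_lip: "\<And>j \<tau> w w'. norm (F j \<tau> w - F j \<tau> w') \<le> \<epsilon>\<^sub>0 * norm (w - w')"
    for F :: "3 \<Rightarrow> real \<Rightarrow> complex \<Rightarrow> complex" and \<tau>\<^sub>0
  proof -
    \<comment> \<open>The weight is frozen after \<open>\<tau>\<^sub>0\<close> so that the equation
      makes sense on the whole line with small coefficients. Up to \<open>\<tau>\<^sub>0\<close> it
      is the true weight.\<close>
    define \<epsilon> where "\<epsilon> = (\<lambda>\<tau>. exp (min \<tau> \<tau>\<^sub>0 / 4))"
    have \<epsilon>: "0 \<le> \<epsilon> \<tau>" "\<epsilon> \<tau> \<le> 1 / 4" "\<epsilon> \<tau> \<le> \<epsilon>\<^sub>0" for \<tau>
    proof -
      have "\<epsilon> \<tau> \<le> exp (\<tau>\<^sub>0 / 4)" "0 \<le> \<epsilon> \<tau>"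
        by (simp_all add: \<epsilon>_def)
      then show "0 \<le> \<epsilon> \<tau>" "\<epsilon> \<tau> \<le> 1 / 4" "\<epsilon> \<tau> \<le> \<epsilon>\<^sub>0"
        using \<tau>\<^sub>0 \<epsilon>\<^sub>0(2) by linarith+
    qed
    define g where "g = (\<lambda>j \<tau> x. nonlinearity j (\<epsilon> \<tau>) x + F j \<tau> (coords x $ j))"
    define G where "G = (\<lambda>\<tau> x. ((g 1 \<tau> x - g 3 \<tau> x, g 2 \<tau> x - g 3 \<tau> x), g 3 \<tau> x))"
    have F_small: "small_map (2 * \<epsilon>\<^sub>0) (\<lambda>x. F j \<tau> (coords x $ j))" for j \<tau>
    proof -
      have "norm (F j \<tau> (coords x $ j)) \<le> 2 * \<epsilon>\<^sub>0" for x
        using F_bound[of j \<tau>] \<epsilon>\<^sub>0(1) by (smt (verit))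
      moreover have "norm (F j \<tau> (coords x $ j) - F j \<tau> (coords y $ j)) \<le> 2 * \<epsilon>\<^sub>0 * norm (x - y)" for x y
      proof -
        have "norm (F j \<tau> (coords x $ j) - F j \<tau> (coords y $ j)) \<le> \<epsilon>\<^sub>0 * norm (coords x $ j - coords y $ j)"
          by (rule F_lip)
        also have "\<dots> \<le> \<epsilon>\<^sub>0 * (2 * norm (x - y))"
          using norm_coords_le[of "x - y" j] \<epsilon>\<^sub>0(1)
          by (intro mult_left_mono) (auto simp: linear_diff[OF bounded_linear.linear[OF bounded_linear_coords]])
        finally show ?thesis by simp
      qed
      ultimately show ?thesis by (simp add: small_map_def)
    qed
    have g_small: "small_map (1042 * \<epsilon>\<^sub>0) (g j \<tau>)" for j \<tau>
    proof -
      have "small_map (1040 * \<epsilon> \<tau> + 2 * \<epsilon>\<^sub>0) (g j \<tau>)"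
        unfolding g_def by (intro small_map_add small_map_nonlinearity F_small \<epsilon>)
      then show ?thesis
        by (rule small_map_mono) (use \<epsilon>(3)[of \<tau>] in simp)
    qed
    \<comment> \<open>Two components of \<open>G\<close> are differences of two small maps and one
      is a single small map: five copies of \<open>1042 * \<epsilon>\<^sub>0\<close>.\<close>
    have "small_map ((1042 * \<epsilon>\<^sub>0 + 1042 * \<epsilon>\<^sub>0) + (1042 * \<epsilon>\<^sub>0 + 1042 * \<epsilon>\<^sub>0) + 1042 * \<epsilon>\<^sub>0) (G \<tau>)" for \<tau>
      unfolding G_def by (intro small_map_Pair small_map_diff g_small)
    then have G_small: "small_map \<eta> (G \<tau>)" for \<tau>
      by (rule small_map_mono) (use \<epsilon>\<^sub>0 in \<open>simp add: \<eta>_def\<close>)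
    have g_cont: "continuous_on (UNIV \<times> cball 0 1) (\<lambda>(\<tau>, x). g j \<tau> x)" for j
    proof -
      have "continuous_on UNIV \<epsilon>"
        unfolding \<epsilon>_def by (intro continuous_intros) auto
      then have "continuous_on (UNIV \<times> cball 0 1) (\<lambda>(\<tau>, x). nonlinearity j (\<epsilon> \<tau>) x)"
        by (rule continuous_on_nonlinearity[OF _ \<epsilon>(1,2)])
      moreover have "continuous_on (UNIV \<times> cball 0 1) (\<lambda>z. (\<lambda>(\<tau>, w). F j \<tau> w) (fst z, coords (snd z) $ j))"
        by (rule continuous_on_compose2[OF F_cont])
          (auto intro!: continuous_on_Pair continuous_intros bounded_linear.continuous_on[OF bounded_linear_coords])
      ultimately show ?thesis
        unfolding g_def case_prod_beta by (intro continuous_on_add) auto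
    qed
    have "continuous_on (UNIV \<times> cball 0 1) (\<lambda>(\<tau>, x). G \<tau> x)"
      unfolding G_def case_prod_beta
      by (intro continuous_on_Pair continuous_on_diff g_cont[unfolded case_prod_beta])
    then obtain x where "\<forall>\<tau>. norm (x \<tau>) \<le> 1 \<and>
        (x has_vector_derivative profile_lin (x \<tau>) + G \<tau> (x \<tau>)) (at \<tau>)"
      using small_bounded_solution_exists[OF S small, of G] G_small
      unfolding small_map_def by auto
    then have x: "norm (x \<tau>) \<le> 1"
      "(x has_vector_derivative profile_lin (x \<tau>) + G \<tau> (x \<tau>)) (at \<tau>)" for \<tau>
      by blast+
    show ?thesis
    proof (intro exI[of _ "\<lambda>\<tau>. coords (x \<tau>)"] allI impI)
      fix \<tau> j assume \<tau>: "\<tau> \<le> \<tau>\<^sub>0"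
      have e: "\<epsilon> \<tau> = exp (\<tau> / 4)" using \<tau> by (simp add: \<epsilon>_def)
      let ?x' = "profile_lin (x \<tau>) + G \<tau> (x \<tau>)"
      \<comment> \<open>The product rule for the weight contributes the \<open>1 / 4\<close>,
        cancelling the shift by -1/4 in \<open>profile_lin\<close>.\<close>
      define D where "D = complex_of_real (exp (\<tau> / 4)) * (coords ?x' $ j + 1 / 4 * coords (x \<tau>) $ j)"
      have "((\<lambda>\<sigma>. coords (x \<sigma>) $ j) has_vector_derivative coords ?x' $ j) (at \<tau>)"
        by (rule bounded_linear.has_vector_derivative[OF bounded_linear_coords x(2)])
      moreover have "((\<lambda>\<sigma>. exp (complex_of_real \<sigma> / 4)) has_vector_derivative exp (complex_of_real \<tau> / 4) / 4) (at \<tau>)"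
        by (rule has_vector_derivative_real_field) (auto intro!: derivative_eq_intros)
      ultimately have "((\<lambda>\<sigma>. exp (complex_of_real \<sigma> / 4) * coords (x \<sigma>) $ j) has_vector_derivative
          exp (complex_of_real \<tau> / 4) * coords ?x' $ j + exp (complex_of_real \<tau> / 4) / 4 * coords (x \<tau>) $ j) (at \<tau>)"
        by (intro has_vector_derivative_mult)
      then have deriv: "((\<lambda>\<sigma>. complex_of_real (exp (\<sigma> / 4)) * coords (x \<sigma>) $ j) has_vector_derivative D) (at \<tau>)"
        by (simp add: D_def exp_of_real[symmetric] algebra_simps)
      have G_j: "\<forall>j. coords (G \<tau> (x \<tau>)) $ j = g j \<tau> (x \<tau>)"
        unfolding forall_3 by (simp add: G_def)
      have "coords ?x' $ j = coords (profile_lin (x \<tau>)) $ j + g j \<tau> (x \<tau>)"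
        using G_j linear_add[OF bounded_linear.linear[OF bounded_linear_coords]] by simp
      then have D_eq: "D = 7 * J * cnj (\<Sum>k\<in>UNIV - {j}. complex_of_real (circ 1 $ k) /
              (burst_coeff 1 $ j + complex_of_real (exp (\<tau> / 4)) * coords (x \<tau>) $ j - (burst_coeff 1 $ k + complex_of_real (exp (\<tau> / 4)) * coords (x \<tau>) $ k)))
            - \<kappa> * (burst_coeff 1 $ j + complex_of_real (exp (\<tau> / 4)) * coords (x \<tau>) $ j)
            + complex_of_real (exp (\<tau> / 4)) * F j \<tau> (coords (x \<tau>) $ j)"
        unfolding vortex_expansion[OF \<epsilon>(1,2)[of \<tau>, unfolded e] x(1)]
        by (simp add: D_def g_def e algebra_simps)
      have "norm ?x' \<le> K + \<eta>"
      proof (rule norm_triangle_mono)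
        show "norm (profile_lin (x \<tau>)) \<le> K"
          using order_trans[OF K(2) mult_right_mono[OF x(1) less_imp_le[OF K(1)]]] by simp
        show "norm (G \<tau> (x \<tau>)) \<le> \<eta>"
          using G_small x(1) by (simp add: small_map_def)
      qed
      \<comment> \<open>Passing from the relative coordinates to a vortex costs a factor 2.\<close>
      then have "norm (coords ?x' $ j + 1 / 4 * coords (x \<tau>) $ j) \<le> 2 * (K + \<eta>) + 1 / 4 * 2"
        using norm_coords_le[of ?x' j] norm_coords_le[of "x \<tau>" j] x(1)[of \<tau>]
        by (intro norm_triangle_mono) (auto simp: norm_mult)
      then have D_le: "norm D \<le> (2 * (K + \<eta>) + 1 / 2) * exp (\<tau> / 4)"
        by (simp add: D_def norm_mult mult.commute)
      show "\<exists>D. (\<forall>k. norm (coords (x \<tau>) $ j - coords (x \<tau>) $ k) \<le> 2) \<and>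
        norm (coords (x \<tau>) $ j) \<le> 2 \<and> norm D \<le> (2 * (K + \<eta>) + 1 / 2) * exp (\<tau> / 4) \<and>
        D = 7 * J * cnj (\<Sum>k\<in>UNIV - {j}. complex_of_real (circ 1 $ k) /
              (burst_coeff 1 $ j + complex_of_real (exp (\<tau> / 4)) * coords (x \<tau>) $ j - (burst_coeff 1 $ k + complex_of_real (exp (\<tau> / 4)) * coords (x \<tau>) $ k)))
            - \<kappa> * (burst_coeff 1 $ j + complex_of_real (exp (\<tau> / 4)) * coords (x \<tau>) $ j)
            + complex_of_real (exp (\<tau> / 4)) * F j \<tau> (coords (x \<tau>) $ j) \<and>
        ((\<lambda>\<sigma>. complex_of_real (exp (\<sigma> / 4)) * coords (x \<sigma>) $ j) has_vector_derivative D) (at \<tau>)"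
      proof (intro exI[of _ D] conjI allI D_le D_eq deriv)
        show "norm (coords (x \<tau>) $ j - coords (x \<tau>) $ k) \<le> 2" for k
          using norm_coords_diff_le[of "x \<tau>" j k] x(1)[of \<tau>] by linarith
        show "norm (coords (x \<tau>) $ j) \<le> 2"
          using norm_coords_le[of "x \<tau>" j] x(1)[of \<tau>] by linarith
      qed
    qed
  qed
  then show ?thesis
    using \<epsilon>\<^sub>0(1,2) by (intro exI[of _ \<epsilon>\<^sub>0] exI[of _ "2 * (K + \<eta>) + 1 / 2"] conjI allI impI) blast+
qed

section \<open>Return to the original variables\<close>

text \<open>The force is given only on \<open>[0, T)\<close>; its value at \<open>T\<close> lets us freeze it for \<open>t \<ge> T\<close> and solve for all times.\<close>

lemma time_lipschitz_extension:
  fixes f :: "real \<Rightarrow> complex \<Rightarrow> complex"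
  assumes T: "T > 0"
    and bound: "\<And>t p. t \<in> {0..<T} \<Longrightarrow> norm (f t p) \<le> M"
    and space: "\<And>t p q. t \<in> {0..<T} \<Longrightarrow> norm (f t p - f t q) \<le> M * norm (p - q)"
    and time: "\<And>s t p. s \<in> {0..<T} \<Longrightarrow> t \<in> {0..<T} \<Longrightarrow> norm (f t p - f s p) \<le> M * \<bar>t - s\<bar>"
  obtains g where "continuous_on ({0..T} \<times> UNIV) g"
    "\<And>t p. t \<in> {0..<T} \<Longrightarrow> g (t, p) = f t p"
    "\<And>t p. t \<in> {0..T} \<Longrightarrow> norm (g (t, p)) \<le> M"
    "\<And>t p q. t \<in> {0..T} \<Longrightarrow> norm (g (t, p) - g (t, q)) \<le> M * norm (p - q)"
proof -
  let ?X = "{0..<T} \<times> (UNIV :: complex set)"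
  have "M \<ge> 0" using order_trans[OF norm_ge_zero bound[of 0 0]] T by simp
  have "(M + M)-lipschitz_on ?X (\<lambda>(t, p). f t p)"
  proof (rule lipschitz_onI)
    fix x y assume "x \<in> ?X" "y \<in> ?X"
    then obtain t p s q where xy: "x = (t, p)" "y = (s, q)" and ts: "t \<in> {0..<T}" "s \<in> {0..<T}"
      by auto
    have "dist (f t p) (f s q) \<le> norm (f t p - f t q) + norm (f t q - f s q)"
      using norm_triangle_ineq[of "f t p - f t q" "f t q - f s q"] by (simp add: dist_norm)
    also have "\<dots> \<le> M * dist p q + M * dist t s"
      using space[OF ts(1), of p q] time[OF ts(2,1), of q] by (simp add: dist_norm)
    also have "\<dots> \<le> M * dist x y + M * dist x y"
      using dist_fst_le[of x y] dist_snd_le[of x y] \<open>M \<ge> 0\<close>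
      unfolding xy by (intro add_mono mult_left_mono) auto
    finally show "dist (case x of (t, p) \<Rightarrow> f t p) (case y of (t, p) \<Rightarrow> f t p) \<le> (M + M) * dist x y"
      by (simp add: xy distrib_right)
  qed (use \<open>M \<ge> 0\<close> in simp)
  then have "uniformly_continuous_on ?X (\<lambda>(t, p). f t p)"
    by (rule lipschitz_on_uniformly_continuous)
  then obtain g where g: "uniformly_continuous_on (closure ?X) g"
    "\<And>x. x \<in> ?X \<Longrightarrow> (\<lambda>(t, p). f t p) x = g x"
    by (rule uniformly_continuous_on_extension_on_closure) auto
  have clos: "closure {0..<T} = {0..T}" using T by simp
  then have cont: "continuous_on ({0..T} \<times> UNIV) g"
    using uniformly_continuous_imp_continuous[OF g(1)] by (simp add: closure_Times)
  have eq: "g (t, p) = f t p" if "t \<in> {0..<T}" for t p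
    using g(2)[of "(t, p)"] that by simp
  have slice: "continuous_on (closure {0..<T}) (\<lambda>t. g (t, p))" for p
    unfolding clos by (rule continuous_on_compose2[OF cont]) (auto intro!: continuous_intros)
  show ?thesis
  proof (rule that[OF cont eq])
    show "norm (g (t, p)) \<le> M" if "t \<in> {0..T}" for t p
      by (rule continuous_on_closure_norm_le[OF slice]) (use that bound eq clos in auto)
    show "norm (g (t, p) - g (t, q)) \<le> M * norm (p - q)" if "t \<in> {0..T}" for t p q
      by (rule continuous_on_closure_norm_le[OF continuous_on_diff[OF slice slice]])
        (use that space eq clos in auto)
  qed
qed

text \<open>The interface between construction and final estimates, in a form stable under
  reflection. The bound \<open>\<delta> / sqrt t\<close> on the derivative of the perturbation is
  chosen because its integral is Hoelder of exponent 1/2.\<close>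

definition near_burst ::
    "real \<Rightarrow> (real \<Rightarrow> complex \<Rightarrow> complex) \<Rightarrow> real \<Rightarrow> real \<Rightarrow> real \<Rightarrow> (real \<Rightarrow> complex ^ 3) \<Rightarrow> bool" where
  "near_burst \<xi> f T C \<delta> z \<longleftrightarrow> (\<forall>t\<in>{0<..<T}. \<forall>j.
     (\<forall>k. j \<noteq> k \<longrightarrow> z t $ j \<noteq> z t $ k) \<and>
     norm (z t $ j) \<le> C * sqrt t \<and>
     ((\<lambda>s. cnj (z s $ j)) has_vector_derivative
        1 / (2 * complex_of_real pi * \<i>) *
          (\<Sum>k\<in>UNIV - {j}. complex_of_real (circ \<xi> $ k) / (z t $ j - z t $ k)) + f t (z t $ j)) (at t) \<and>
     (\<exists>E. ((\<lambda>s. z s $ j - burst \<xi> s $ j) has_vector_derivative E) (at t) \<and> norm E \<le> \<delta> / sqrt t))"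

section \<open>The burst and the force in logarithmic time\<close>

lemma burst_a_pos: "\<xi> \<noteq> 0 \<Longrightarrow> burst_a \<xi> > 0"
  by (auto simp: burst_a_def linorder_neq_iff mult_pos_neg divide_neg_pos)

lemma exp_\<kappa>_ln:
  assumes "t > 0"
  shows "exp (\<kappa> * complex_of_real (ln t)) = sqrt t * exp (\<i> * complex_of_real (5 / 6 * sqrt 3 * ln t))"
proof -
  have "\<kappa> * complex_of_real (ln t) = complex_of_real (ln t / 2) + \<i> * complex_of_real (5 / 6 * sqrt 3 * ln t)"
    by (simp add: \<kappa>_def J_def algebra_simps)
  moreover have "exp (ln t / 2) = sqrt t"
    using assms by (simp flip: ln_sqrt)
  ultimately show ?thesis
    by (simp only: exp_add exp_of_real)
qed

lemma burst_Z_eq: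
  assumes "\<xi> > 0" "t > 0"
  shows "burst_Z \<xi> t = sqrt (2 * burst_a \<xi>) * exp (\<kappa> * complex_of_real (ln t))"
proof -
  have eq: "burst_b \<xi> / (2 * burst_a \<xi>) * ln t = 5 / 6 * sqrt 3 * ln t"
    using assms(1) by (simp add: burst_a_def burst_b_def field_simps)
  show ?thesis
    unfolding exp_\<kappa>_ln[OF assms(2)] burst_Z_def eq by (simp add: real_sqrt_mult)
qed

lemma norm_exp_\<kappa>: "norm (exp (\<kappa> * complex_of_real \<tau>)) = exp (\<tau> / 2)"
  by (simp add: norm_exp_eq_Re)

lemma norm_exp_\<kappa>_shift: "norm (exp ((\<kappa> - 1 / 4) * complex_of_real \<tau>)) = exp (\<tau> / 4)"
  by (simp add: norm_exp_eq_Re algebra_simps)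

lemma burst_pos:
  assumes "\<xi> > 0"
  shows "burst \<xi> t $ j = burst_coeff 1 $ j * burst_Z \<xi> t"
  using assms by (simp add: burst_def burst_coeff_def)

text \<open>In the profile equation the force becomes
  \<open>t * cnj f / Z = cnj (Z * f) / (2 * a)\<close>. With \<open>m\<^sup>2 = 2 * a\<close> this
  is \<open>cnj (exp (\<kappa> * \<tau>) * f) / m\<close>, and division by the weight
  \<open>exp (\<tau> / 4)\<close> lowers \<open>\<kappa>\<close> by 1/4.\<close>

definition log_forcing ::
    "real \<Rightarrow> (real \<times> complex \<Rightarrow> complex) \<Rightarrow> 3 \<Rightarrow> real \<Rightarrow> complex \<Rightarrow> complex" where
  "log_forcing m g j \<tau> w = cnj (exp ((\<kappa> - 1 / 4) * complex_of_real \<tau>) *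
     g (exp \<tau>, m * exp (\<kappa> * complex_of_real \<tau>) * (burst_coeff 1 $ j + complex_of_real (exp (\<tau> / 4)) * w))) / m"

lemma norm_log_forcing_le:
  assumes "m > 0" "\<tau> \<le> \<tau>\<^sub>0" "\<And>t p. t \<in> {0..exp \<tau>\<^sub>0} \<Longrightarrow> norm (g (t, p)) \<le> M"
  shows "norm (log_forcing m g j \<tau> w) \<le> M / m * exp (\<tau>\<^sub>0 / 4)"
proof -
  have "exp (\<tau> / 4) * norm (g (exp \<tau>, p)) \<le> exp (\<tau>\<^sub>0 / 4) * M" for p
    using assms(2,3) by (intro mult_mono) auto
  then have "exp (\<tau> / 4) * norm (g (exp \<tau>, p)) / m \<le> exp (\<tau>\<^sub>0 / 4) * M / m" for p
    using assms(1) by (intro divide_right_mono) auto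
  also have "exp (\<tau>\<^sub>0 / 4) * M / m = M / m * exp (\<tau>\<^sub>0 / 4)"
    by simp
  finally have *: "exp (\<tau> / 4) * norm (g (exp \<tau>, p)) / m \<le> M / m * exp (\<tau>\<^sub>0 / 4)" for p .
  show ?thesis
    unfolding log_forcing_def norm_divide complex_mod_cnj norm_mult norm_exp_\<kappa>_shift
    using assms(1) * by simp
qed

text \<open>Positions depend on \<open>w\<close> through \<open>Z\<close> and the weight. With the
  prefactor the exponents add up to 1/4 + 1/2 + 1/4 = 1, so the Lipschitz constant is
  \<open>M\<close> times the final time.\<close>

lemma log_forcing_lipschitz:
  assumes "m > 0" "\<tau> \<le> \<tau>\<^sub>0" "M \<ge> 0"
    "\<And>t p q. t \<in> {0..exp \<tau>\<^sub>0} \<Longrightarrow> norm (g (t, p) - g (t, q)) \<le> M * norm (p - q)"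
  shows "norm (log_forcing m g j \<tau> w - log_forcing m g j \<tau> w') \<le> M * exp \<tau>\<^sub>0 * norm (w - w')"
proof -
  let ?Z = "m * exp (\<kappa> * complex_of_real \<tau>)" and ?e = "complex_of_real (exp (\<tau> / 4))"
  let ?p = "\<lambda>w. ?Z * (burst_coeff 1 $ j + ?e * w)"
  have eq: "log_forcing m g j \<tau> w - log_forcing m g j \<tau> w'
      = cnj (exp ((\<kappa> - 1 / 4) * complex_of_real \<tau>) * (g (exp \<tau>, ?p w) - g (exp \<tau>, ?p w'))) / m"
    by (simp add: log_forcing_def right_diff_distrib diff_divide_distrib)
  have "norm (log_forcing m g j \<tau> w - log_forcing m g j \<tau> w')
      = exp (\<tau> / 4) * norm (g (exp \<tau>, ?p w) - g (exp \<tau>, ?p w')) / m"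
    unfolding eq norm_divide complex_mod_cnj norm_mult norm_exp_\<kappa>_shift using assms(1) by simp
  also have "\<dots> \<le> exp (\<tau> / 4) * (M * norm (?p w - ?p w')) / m"
    using assms(1,2) by (intro divide_right_mono mult_left_mono assms(4)) auto
  also have "?p w - ?p w' = ?Z * ?e * (w - w')"
    by (simp add: algebra_simps)
  also have "norm \<dots> = m * exp (\<tau> / 2) * exp (\<tau> / 4) * norm (w - w')"
    using assms(1) by (simp add: norm_mult norm_exp_\<kappa>)
  also have "exp (\<tau> / 4) * (M * (m * exp (\<tau> / 2) * exp (\<tau> / 4) * norm (w - w'))) / m
      = M * (exp (\<tau> / 4) * exp (\<tau> / 2) * exp (\<tau> / 4)) * norm (w - w')"
    using assms(1) by simp
  also have "exp (\<tau> / 4) * exp (\<tau> / 2) * exp (\<tau> / 4) = exp \<tau>"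
    by (simp flip: exp_add)
  also have "M * exp \<tau> * norm (w - w') \<le> M * exp \<tau>\<^sub>0 * norm (w - w')"
    using assms(2,3) by (intro mult_right_mono mult_left_mono) auto
  finally show ?thesis .
qed

lemma continuous_on_log_forcing:
  assumes "m > 0" "continuous_on ({0..exp \<tau>\<^sub>0} \<times> UNIV) g"
  shows "continuous_on UNIV (\<lambda>(\<tau>, w). log_forcing m g j (min \<tau> \<tau>\<^sub>0) w)"
  unfolding log_forcing_def case_prod_beta
  using assms(1)
  by (intro continuous_intros continuous_on_compose2[OF assms(2)]) auto

lemma norm_burst_Z:
  assumes "\<xi> > 0" "t > 0"
  shows "norm (burst_Z \<xi> t) = sqrt (2 * burst_a \<xi>) * sqrt t"
  using burst_a_pos[of \<xi>] assms by (simp add: burst_Z_def norm_mult real_sqrt_mult)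

lemma burst_Z_modulate_has_vector_derivative:
  assumes "\<xi> > 0" "t > 0" "(h has_vector_derivative h') (at (ln t))"
  shows "((\<lambda>s. burst_Z \<xi> s * h (ln s)) has_vector_derivative
    (1 / t) *\<^sub>R (burst_Z \<xi> t * (\<kappa> * h (ln t) + h'))) (at t)"
proof -
  let ?m = "complex_of_real (sqrt (2 * burst_a \<xi>))"
  let ?Y = "\<lambda>\<tau>. ?m * exp (\<kappa> * complex_of_real \<tau>)"
  have "(?Y has_vector_derivative \<kappa> * ?Y (ln t)) (at (ln t))"
    by (rule has_vector_derivative_real_field) (auto intro!: derivative_eq_intros)
  then have "((\<lambda>\<tau>. ?Y \<tau> * h \<tau>) has_vector_derivative ?Y (ln t) * h' + \<kappa> * ?Y (ln t) * h (ln t)) (at (ln t))"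
    using assms(3) by (rule has_vector_derivative_mult)
  moreover have "(ln has_vector_derivative 1 / t) (at t)"
    using DERIV_ln_divide[OF assms(2)] by (simp add: has_real_derivative_iff_has_vector_derivative)
  ultimately have "((\<lambda>\<tau>. ?Y \<tau> * h \<tau>) \<circ> ln has_vector_derivative
      (1 / t) *\<^sub>R (?Y (ln t) * h' + \<kappa> * ?Y (ln t) * h (ln t))) (at t)"
    by (intro vector_diff_chain_at)
  then have "((\<lambda>s. burst_Z \<xi> s * h (ln s)) has_vector_derivative
      (1 / t) *\<^sub>R (?Y (ln t) * h' + \<kappa> * ?Y (ln t) * h (ln t))) (at t)"
    by (rule has_vector_derivative_transform_within_open[where S = "{0<..}"])
      (use assms(1,2) burst_Z_eq in auto)
  then show ?thesis
    by (simp add: burst_Z_eq[OF assms(1,2)] algebra_simps)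
qed

text \<open>The identity |Z|^2 = 2 a t turns \<open>cnj Z / t\<close> into \<open>2 * a / Z\<close>,
  and \<open>a * J = \<i> * \<xi> / (28 * pi)\<close> turns the factor \<open>- 14 * a * J\<close>
  into \<open>\<xi> / (2 * pi * \<i>)\<close>.\<close>

lemma modulated_equation:
  assumes "\<xi> > 0" "t > 0"
  defines "Z \<equiv> burst_Z \<xi> t" and "a \<equiv> complex_of_real (burst_a \<xi>)"
  shows "cnj ((1 / t) *\<^sub>R (Z * (7 * J * cnj S + cnj (Z * p) / (2 * a)))) =
    1 / (2 * complex_of_real pi * \<i>) * (complex_of_real \<xi> * S / Z) + p"
proof -
  have a: "a \<noteq> 0" using burst_a_pos[of \<xi>] assms(1) by (simp add: a_def)
  have "norm Z ^ 2 = 2 * burst_a \<xi> * t"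
    unfolding Z_def norm_burst_Z[OF assms(1,2)]
    using burst_a_pos[of \<xi>] assms(1,2) by (simp add: power_mult_distrib)
  then have ZZ: "Z * cnj Z = 2 * a * complex_of_real t"
    by (simp add: a_def flip: complex_norm_square)
  then have Z: "Z \<noteq> 0" using a assms(2) by auto
  have t: "complex_of_real t \<noteq> 0" using assms(2) by simp
  have aJ: "a * J = \<i> * complex_of_real \<xi> / (28 * complex_of_real pi)"
  proof -
    have "complex_of_real (sqrt 3) * complex_of_real (sqrt 3) = 3"
      by (simp flip: of_real_mult)
    then show ?thesis
      using assms(1) by (simp add: a_def J_def burst_a_def field_simps)
  qed
  have cZ: "cnj Z = 2 * a * complex_of_real t / Z"
    using ZZ Z by (simp add: field_simps)
  have "cnj ((1 / t) *\<^sub>R (Z * (7 * J * cnj S + cnj (Z * p) / (2 * a))))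
      = cnj Z / complex_of_real t * (- 7 * J * S + Z * p / (2 * a))"
    by (simp add: scaleR_conv_of_real a_def)
  also have "\<dots> = - 14 * (a * J) * S / Z + p"
    unfolding cZ using Z t a by (simp add: field_simps)
  also have "\<dots> = 1 / (2 * complex_of_real pi * \<i>) * (complex_of_real \<xi> * S / Z) + p"
    unfolding aJ using Z by (simp add: field_simps)
  finally show ?thesis .
qed

text \<open>The real-valued consequences of \<open>E_norm T f \<le> ennreal M\<close> on which the
  construction rests. They are preserved by reflection.\<close>

definition lipschitz_force :: "real \<Rightarrow> real \<Rightarrow> (real \<Rightarrow> complex \<Rightarrow> complex) \<Rightarrow> bool" where
  "lipschitz_force T M f \<longleftrightarrow> (\<forall>t\<in>{0..<T}.
     (\<forall>p. norm (f t p) \<le> M) \<and> (\<forall>p q. norm (f t p - f t q) \<le> M * norm (p - q)) \<and>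
     (\<forall>s\<in>{0..<T}. \<forall>p. norm (f t p - f s p) \<le> M * \<bar>t - s\<bar>))"

text \<open>The order of the quantifiers matters: \<open>C\<close> depends on \<open>\<xi>\<close>
  alone, so every later smallness can be achieved by shortening the time interval.\<close>

lemma near_burst_exists_pos:
  assumes \<xi>: "\<xi> > 0"
  shows "\<exists>C>0. \<forall>M>0. \<forall>\<delta>>0. \<exists>T'>0. \<forall>T f. 0 < T \<longrightarrow> T < T' \<longrightarrow> lipschitz_force T M f \<longrightarrow>
    (\<exists>z. near_burst \<xi> f T C \<delta> z)"
proof -
  let ?b = "\<lambda>j. burst_coeff 1 $ j"
  define m where "m = sqrt (2 * burst_a \<xi>)"
  have m: "m > 0" "m\<^sup>2 = 2 * burst_a \<xi>"
    using burst_a_pos[of \<xi>] \<xi> by (simp_all add: m_def)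
  \<comment> \<open>The profile is a burst coefficient plus a displacement of norm at most 1/2, and
    |Z| = \<open>m * sqrt t\<close>.\<close>
  define C where "C = m * (norm (burst_coeff 1) + 1)"
  have "C > 0" unfolding C_def using m(1) by (intro mult_pos_pos add_nonneg_pos) auto
  obtain \<epsilon>\<^sub>0 K where \<epsilon>\<^sub>0: "0 < \<epsilon>\<^sub>0" "\<epsilon>\<^sub>0 \<le> 1 / 4" and profile: "\<forall>F \<tau>\<^sub>0. exp (\<tau>\<^sub>0 / 4) \<le> \<epsilon>\<^sub>0 \<longrightarrow>
     (\<forall>j. continuous_on UNIV (\<lambda>(\<tau>, w). F j \<tau> w)) \<longrightarrow>
     (\<forall>j \<tau> w. norm (F j \<tau> w) \<le> \<epsilon>\<^sub>0) \<longrightarrow>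
     (\<forall>j \<tau> w w'. norm (F j \<tau> w - F j \<tau> w') \<le> \<epsilon>\<^sub>0 * norm (w - w')) \<longrightarrow>
     (\<exists>v :: real \<Rightarrow> complex ^ 3. \<forall>\<tau>\<le>\<tau>\<^sub>0. \<forall>j. \<exists>D.
        (\<forall>k. norm (v \<tau> $ j - v \<tau> $ k) \<le> 2) \<and>
        norm (v \<tau> $ j) \<le> 2 \<and> norm D \<le> K * exp (\<tau> / 4) \<and>
        D = 7 * J * cnj (\<Sum>k\<in>UNIV - {j}. complex_of_real (circ 1 $ k) /
              (?b j + complex_of_real (exp (\<tau> / 4)) * v \<tau> $ j - (?b k + complex_of_real (exp (\<tau> / 4)) * v \<tau> $ k)))
            - \<kappa> * (?b j + complex_of_real (exp (\<tau> / 4)) * v \<tau> $ j) + complex_of_real (exp (\<tau> / 4)) * F j \<tau> (v \<tau> $ j) \<and>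
        ((\<lambda>\<sigma>. complex_of_real (exp (\<sigma> / 4)) * v \<sigma> $ j) has_vector_derivative D) (at \<tau>))"
    using perturbed_profile_exists by blast
  have "\<exists>T'>0. \<forall>T f. 0 < T \<longrightarrow> T < T' \<longrightarrow> lipschitz_force T M f \<longrightarrow> (\<exists>z. near_burst \<xi> f T C \<delta> z)"
    if "M > 0" "\<delta> > 0" for M \<delta>
  proof -
    \<comment> \<open>\<open>L\<close> bounds the derivative of the perturbation: it collects |Z| /
      sqrt t = \<open>m\<close>, the size 2 of the rescaled displacement under
      \<open>\<kappa>\<close>, and the bound \<open>K\<close> for \<open>D\<close>.\<close>
    define L where "L = m * (2 * norm \<kappa> + \<bar>K\<bar>) + 1"
    have L: "L > 0" unfolding L_def using m(1) by (intro add_nonneg_pos mult_nonneg_nonneg) auto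
    \<comment> \<open>\<open>c\<close> caps the weight \<open>exp (\<tau>\<^sub>0 / 4)\<close>. The
      three entries serve the profile lemma, the size of the force and the target
      \<open>\<delta>\<close>.\<close>
    define c where "c = min \<epsilon>\<^sub>0 (min (\<epsilon>\<^sub>0 * m / M) (\<delta> / L))"
    have c: "c > 0" "c \<le> \<epsilon>\<^sub>0" "c \<le> \<epsilon>\<^sub>0 * m / M" "c \<le> \<delta> / L"
      using \<epsilon>\<^sub>0 m(1) that L by (auto simp: c_def)
    \<comment> \<open>At the end time the weight is the fourth root of \<open>T\<close>, hence
      \<open>c ^ 4\<close>; the second entry makes the Lipschitz constant \<open>M * T\<close> of
      the force at most \<open>\<epsilon>\<^sub>0\<close>.\<close>
    define T' where "T' = min (c ^ 4) (\<epsilon>\<^sub>0 / M)"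
    have "\<exists>z. near_burst \<xi> f T C \<delta> z" if T: "0 < T" "T < T'" and f: "lipschitz_force T M f" for T f
    proof -
      define \<tau>\<^sub>0 where "\<tau>\<^sub>0 = ln T"
      have exp_\<tau>\<^sub>0: "exp \<tau>\<^sub>0 = T" using T by (simp add: \<tau>\<^sub>0_def)
      have "exp (\<tau>\<^sub>0 / 4) ^ 4 < c ^ 4"
        using T exp_\<tau>\<^sub>0 by (simp add: T'_def flip: exp_of_nat_mult)
      then have e_le: "exp (\<tau>\<^sub>0 / 4) \<le> c"
        using c(1) by (meson less_imp_le power_less_imp_less_base)
      obtain g where g: "continuous_on ({0..T} \<times> UNIV) g"
        "\<And>t p. t \<in> {0..<T} \<Longrightarrow> g (t, p) = f t p"
        "\<And>t p. t \<in> {0..T} \<Longrightarrow> norm (g (t, p)) \<le> M"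
        "\<And>t p q. t \<in> {0..T} \<Longrightarrow> norm (g (t, p) - g (t, q)) \<le> M * norm (p - q)"
        by (rule time_lipschitz_extension[OF T(1), of f M]) (use f in \<open>auto simp: lipschitz_force_def\<close>)
      define F where "F = (\<lambda>j \<tau>. log_forcing m g j (min \<tau> \<tau>\<^sub>0))"
      have "continuous_on UNIV (\<lambda>(\<tau>, w). F j \<tau> w)" for j
        unfolding F_def by (rule continuous_on_log_forcing[OF m(1)]) (simp add: exp_\<tau>\<^sub>0 g(1))
      moreover have "norm (F j \<tau> w) \<le> \<epsilon>\<^sub>0" for j \<tau> w
      proof -
        have "norm (F j \<tau> w) \<le> M / m * exp (\<tau>\<^sub>0 / 4)"
          unfolding F_def by (rule norm_log_forcing_le[OF m(1)]) (use g(3) exp_\<tau>\<^sub>0 in auto)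
        also have "\<dots> \<le> M / m * (\<epsilon>\<^sub>0 * m / M)"
          using e_le c(3) \<open>M > 0\<close> m(1) by (intro mult_left_mono) auto
        also have "\<dots> = \<epsilon>\<^sub>0" using \<open>M > 0\<close> m(1) by simp
        finally show ?thesis .
      qed
      moreover have "norm (F j \<tau> w - F j \<tau> w') \<le> \<epsilon>\<^sub>0 * norm (w - w')" for j \<tau> w w'
      proof -
        have "norm (F j \<tau> w - F j \<tau> w') \<le> M * exp \<tau>\<^sub>0 * norm (w - w')"
          unfolding F_def by (rule log_forcing_lipschitz[OF m(1)]) (use g(4) exp_\<tau>\<^sub>0 \<open>M > 0\<close> in auto)
        also have "\<dots> \<le> \<epsilon>\<^sub>0 * norm (w - w')"
          using T(2) \<open>M > 0\<close> unfolding exp_\<tau>\<^sub>0 T'_def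
          by (intro mult_right_mono) (auto simp: field_simps)
        finally show ?thesis .
      qed
      ultimately obtain v :: "real \<Rightarrow> complex ^ 3" where v: "\<And>\<tau> j. \<tau> \<le> \<tau>\<^sub>0 \<Longrightarrow> \<exists>D.
        (\<forall>k. norm (v \<tau> $ j - v \<tau> $ k) \<le> 2) \<and>
        norm (v \<tau> $ j) \<le> 2 \<and> norm D \<le> K * exp (\<tau> / 4) \<and>
        D = 7 * J * cnj (\<Sum>k\<in>UNIV - {j}. complex_of_real (circ 1 $ k) /
              (?b j + complex_of_real (exp (\<tau> / 4)) * v \<tau> $ j - (?b k + complex_of_real (exp (\<tau> / 4)) * v \<tau> $ k)))
            - \<kappa> * (?b j + complex_of_real (exp (\<tau> / 4)) * v \<tau> $ j) + complex_of_real (exp (\<tau> / 4)) * F j \<tau> (v \<tau> $ j) \<and>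
        ((\<lambda>\<sigma>. complex_of_real (exp (\<sigma> / 4)) * v \<sigma> $ j) has_vector_derivative D) (at \<tau>)"
        using profile[rule_format, of \<tau>\<^sub>0 F] order_trans[OF e_le c(2)] by blast
      define y where "y = (\<lambda>j \<tau>. complex_of_real (exp (\<tau> / 4)) * v \<tau> $ j)"
      define U where "U = (\<lambda>j \<tau>. ?b j + y j \<tau>)"
      define z where "z = (\<lambda>t. \<chi> j. burst_Z \<xi> t * U j (ln t))"
      have "near_burst \<xi> f T C \<delta> z"
        unfolding near_burst_def
      proof (intro ballI allI conjI impI)
        fix t j assume "t \<in> {0<..<T}"
        then have t: "0 < t" "t < T" by auto
        let ?Z = "burst_Z \<xi> t" and ?\<tau> = "ln t"
        have \<tau>: "?\<tau> < \<tau>\<^sub>0" using t by (simp add: \<tau>\<^sub>0_def)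
        then have e: "exp (?\<tau> / 4) \<le> exp (\<tau>\<^sub>0 / 4)" by simp
        have e4: "exp (?\<tau> / 4) \<le> 1 / 4"
          using e e_le c(2) \<epsilon>\<^sub>0(2) by linarith
        have Z: "norm ?Z = m * sqrt t" "?Z \<noteq> 0"
          using norm_burst_Z[OF \<xi> t(1)] m(1) t(1) by (auto simp: m_def)
        obtain D where D: "\<And>k. norm (v ?\<tau> $ j - v ?\<tau> $ k) \<le> 2" "norm (v ?\<tau> $ j) \<le> 2"
          "norm D \<le> K * exp (?\<tau> / 4)"
          "D = 7 * J * cnj (\<Sum>k\<in>UNIV - {j}. complex_of_real (circ 1 $ k) / (U j ?\<tau> - U k ?\<tau>))
            - \<kappa> * U j ?\<tau> + complex_of_real (exp (?\<tau> / 4)) * F j ?\<tau> (v ?\<tau> $ j)"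
          "(y j has_vector_derivative D) (at ?\<tau>)"
          using v[OF less_imp_le[OF \<tau>], of j] unfolding U_def y_def by blast
        have y_le: "norm (y j ?\<tau>) \<le> exp (?\<tau> / 4) * 2"
          using D(2) by (simp add: y_def norm_mult)
        show "z t $ j \<noteq> z t $ k" if "j \<noteq> k" for k
        proof -
          have "U j ?\<tau> - U k ?\<tau> = (?b j - ?b k) + of_real (exp (?\<tau> / 4)) * (v ?\<tau> $ j - v ?\<tau> $ k)"
            by (simp add: U_def y_def algebra_simps)
          then have "U j ?\<tau> - U k ?\<tau> \<noteq> 0"
            using perturbed_nonzero[OF norm_gap_ge[OF that] D(1) _ e4] by simp
          then show ?thesis using Z(2) by (simp add: z_def)
        qed
        have "norm (U j ?\<tau>) \<le> norm (burst_coeff 1) + 1"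
          unfolding U_def using y_le e4 Finite_Cartesian_Product.norm_nth_le[of "burst_coeff 1" j]
          by (intro norm_triangle_mono) auto
        then have "m * sqrt t * norm (U j ?\<tau>) \<le> m * sqrt t * (norm (burst_coeff 1) + 1)"
          using m(1) t by (intro mult_left_mono) auto
        then show "norm (z t $ j) \<le> C * sqrt t"
          by (simp add: z_def norm_mult Z(1) C_def mult_ac)
        have "(U j has_vector_derivative D) (at ?\<tau>)"
          unfolding U_def using D(5) by (auto intro!: derivative_eq_intros)
        from burst_Z_modulate_has_vector_derivative[OF \<xi> t(1) this]
        have "((\<lambda>s. cnj (z s $ j)) has_vector_derivative cnj ((1 / t) *\<^sub>R (?Z * (\<kappa> * U j ?\<tau> + D)))) (at t)"
          using bounded_linear.has_vector_derivative[OF bounded_linear_cnj] by (fastforce simp: z_def)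
        moreover have "cnj ((1 / t) *\<^sub>R (?Z * (\<kappa> * U j ?\<tau> + D)))
          = 1 / (2 * complex_of_real pi * \<i>) *
          (\<Sum>k\<in>UNIV - {j}. complex_of_real (circ \<xi> $ k) / (z t $ j - z t $ k)) + f t (z t $ j)"
        proof -
          let ?S = "\<Sum>k\<in>UNIV - {j}. complex_of_real (circ 1 $ k) / (U j ?\<tau> - U k ?\<tau>)"
          have circ: "circ \<xi> $ k = \<xi> * circ 1 $ k" for k
          proof -
            have "\<forall>k. circ \<xi> $ k = \<xi> * circ 1 $ k"
              unfolding forall_3 by simp
            then show ?thesis by blast
          qed
          have "(\<Sum>k\<in>UNIV - {j}. complex_of_real (circ \<xi> $ k) / (z t $ j - z t $ k))
              = (\<Sum>k\<in>UNIV - {j}. complex_of_real \<xi> / ?Z * (complex_of_real (circ 1 $ k) / (U j ?\<tau> - U k ?\<tau>)))"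
            by (intro sum.cong refl) (simp add: circ[of _] z_def flip: right_diff_distrib)
          also have "\<dots> = complex_of_real \<xi> / ?Z * ?S"
            by (rule sum_distrib_left[symmetric])
          finally have sum: "(\<Sum>k\<in>UNIV - {j}. complex_of_real (circ \<xi> $ k) / (z t $ j - z t $ k))
              = complex_of_real \<xi> * ?S / ?Z"
            by simp
          have Zeq: "?Z = m * exp (\<kappa> * complex_of_real ?\<tau>)"
            using burst_Z_eq[OF \<xi> t(1)] by (simp add: m_def)
          have mm: "complex_of_real m * complex_of_real m = 2 * complex_of_real (burst_a \<xi>)"
          proof -
            have "complex_of_real (m * m) = complex_of_real (2 * burst_a \<xi>)"
              using m(2) by (simp only: power2_eq_square)
            then show ?thesis by simp
          qed
          have "complex_of_real (exp (?\<tau> / 4)) * exp ((\<kappa> - 1 / 4) * complex_of_real ?\<tau>)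
              = exp (\<kappa> * complex_of_real ?\<tau>)"
            by (simp add: algebra_simps flip: exp_of_real exp_add)
          then have "complex_of_real (exp (?\<tau> / 4)) * cnj (exp ((\<kappa> - 1 / 4) * complex_of_real ?\<tau>))
              = cnj (exp (\<kappa> * complex_of_real ?\<tau>))"
            by (metis complex_cnj_mult complex_cnj_complex_of_real)
          then have "complex_of_real (exp (?\<tau> / 4)) * F j ?\<tau> (v ?\<tau> $ j)
              = cnj (exp (\<kappa> * complex_of_real ?\<tau>) * f t (z t $ j)) / m"
            using \<tau> t g(2)[of t "z t $ j"]
            by (simp add: F_def log_forcing_def Zeq z_def U_def y_def m_def mult.assoc flip: exp_cnj)
          also have "\<dots> = cnj (?Z * f t (z t $ j)) / (2 * complex_of_real (burst_a \<xi>))"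
            unfolding Zeq mm[symmetric] using m(1) by simp
          finally have "\<kappa> * U j ?\<tau> + D = 7 * J * cnj ?S + cnj (?Z * f t (z t $ j)) / (2 * complex_of_real (burst_a \<xi>))"
            unfolding D(4) by simp
          then show ?thesis
            unfolding sum by (simp only: modulated_equation[OF \<xi> t(1)])
        qed
        ultimately show "((\<lambda>s. cnj (z s $ j)) has_vector_derivative
          1 / (2 * complex_of_real pi * \<i>) *
          (\<Sum>k\<in>UNIV - {j}. complex_of_real (circ \<xi> $ k) / (z t $ j - z t $ k)) + f t (z t $ j)) (at t)"
          by simp
        \<comment> \<open>The perturbation is \<open>Z * y\<close>. Both \<open>y\<close> and its
          derivative \<open>D\<close> carry the small weight, while |Z| / t = m / sqrt t gives the
          admissible singularity at 0.\<close>
        let ?E = "(1 / t) *\<^sub>R (?Z * (\<kappa> * y j ?\<tau> + D))"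
        show "\<exists>E. ((\<lambda>s. z s $ j - burst \<xi> s $ j) has_vector_derivative E) (at t) \<and> norm E \<le> \<delta> / sqrt t"
        proof (intro exI[of _ ?E] conjI)
          have "(\<lambda>s. z s $ j - burst \<xi> s $ j) = (\<lambda>s. burst_Z \<xi> s * y j (ln s))"
            using \<xi> by (simp add: z_def U_def burst_pos algebra_simps)
          then show "((\<lambda>s. z s $ j - burst \<xi> s $ j) has_vector_derivative ?E) (at t)"
            using burst_Z_modulate_has_vector_derivative[OF \<xi> t(1) D(5)] by simp
          have "norm D \<le> \<bar>K\<bar> * exp (?\<tau> / 4)"
            by (rule order_trans[OF D(3) mult_right_mono]) auto
          then have "norm (\<kappa> * y j ?\<tau> + D) \<le> norm \<kappa> * (exp (?\<tau> / 4) * 2) + \<bar>K\<bar> * exp (?\<tau> / 4)"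
            using y_le by (intro norm_triangle_mono) (auto simp: norm_mult intro: mult_left_mono)
          also have "\<dots> = (2 * norm \<kappa> + \<bar>K\<bar>) * exp (?\<tau> / 4)" by (simp add: algebra_simps)
          also have "\<dots> \<le> (2 * norm \<kappa> + \<bar>K\<bar>) * (\<delta> / L)"
            by (rule mult_left_mono[OF order_trans[OF e order_trans[OF e_le c(4)]]]) auto
          finally have "m * norm (\<kappa> * y j ?\<tau> + D) \<le> m * ((2 * norm \<kappa> + \<bar>K\<bar>) * (\<delta> / L))"
            using m(1) by (intro mult_left_mono) auto
          also have "\<dots> = (L - 1) * (\<delta> / L)" by (simp add: L_def)
          also have "\<dots> \<le> L * (\<delta> / L)" using L \<open>\<delta> > 0\<close> by (intro mult_right_mono) auto
          also have "\<dots> = \<delta>" using L by simp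
          finally have "m * norm (\<kappa> * y j ?\<tau> + D) * (sqrt t / t) \<le> \<delta> * (sqrt t / t)"
            using t by (intro mult_right_mono) auto
          moreover have "sqrt t / t = 1 / sqrt t"
            using t(1) by (simp add: field_simps)
          moreover have "norm ?E = m * norm (\<kappa> * y j ?\<tau> + D) * (sqrt t / t)"
            unfolding norm_scaleR norm_mult Z(1) using t(1) by simp
          ultimately show "norm ?E \<le> \<delta> / sqrt t"
            by simp
        qed
      qed
      then show ?thesis by blast
    qed
    moreover have "T' > 0" using c(1) \<epsilon>\<^sub>0(1) \<open>M > 0\<close> by (simp add: T'_def)
    ultimately show ?thesis by blast
  qed
  then show ?thesis using \<open>C > 0\<close> by blast
qed

section \<open>Reflection to negative circulations\<close>

lemma burst_reflect:
  assumes "\<xi> \<noteq> 0"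
  shows "burst (- \<xi>) t $ j = - cnj (burst \<xi> t $ j)"
proof -
  have "\<forall>j. burst_coeff (- \<xi>) $ j = - cnj (burst_coeff \<xi> $ j)"
    unfolding forall_3 using assms by (auto simp: burst_coeff_def)
  moreover have "burst_a (- \<xi>) = burst_a \<xi>" "burst_b (- \<xi>) = - burst_b \<xi>"
    using assms by (auto simp: burst_a_def burst_b_def)
  ultimately show ?thesis
    by (simp add: burst_def burst_Z_def exp_cnj)
qed

text \<open>Circulations and gaps change sign, so the interaction sum \<open>S\<close> turns into
  \<open>cnj S\<close>. Since \<open>- cnj (1 / (2 * pi * \<i>))\<close> is
  \<open>1 / (2 * pi * \<i>)\<close> again, the equation keeps its form with the reflected
  force.\<close>

lemma near_burst_reflect:
  assumes "\<xi> \<noteq> 0" "near_burst \<xi> f T C \<delta> z"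
  shows "near_burst (- \<xi>) (\<lambda>t p. - cnj (f t (- cnj p))) T C \<delta> (\<lambda>t. \<chi> j. - cnj (z t $ j))"
  unfolding near_burst_def
proof (intro ballI allI)
  fix t j assume t: "t \<in> {0<..<T}"
  define S where "S = (\<Sum>k\<in>UNIV - {j}. complex_of_real (circ \<xi> $ k) / (z t $ j - z t $ k))"
  from assms(2) t obtain E where z: "\<And>k. j \<noteq> k \<Longrightarrow> z t $ j \<noteq> z t $ k" "norm (z t $ j) \<le> C * sqrt t"
    "((\<lambda>s. cnj (z s $ j)) has_vector_derivative
        1 / (2 * complex_of_real pi * \<i>) * S + f t (z t $ j)) (at t)"
    "((\<lambda>s. z s $ j - burst \<xi> s $ j) has_vector_derivative E) (at t)" "norm E \<le> \<delta> / sqrt t"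
    unfolding near_burst_def S_def by blast
  have circ: "\<forall>k. circ (- \<xi>) $ k = - circ \<xi> $ k"
    unfolding forall_3 by simp
  have "(\<Sum>k\<in>UNIV - {j}. complex_of_real (circ (- \<xi>) $ k) /
      ((\<chi> j. - cnj (z t $ j)) $ j - (\<chi> j. - cnj (z t $ j)) $ k)) = cnj S"
  proof -
    have "complex_of_real (circ (- \<xi>) $ k) / ((\<chi> j. - cnj (z t $ j)) $ j - (\<chi> j. - cnj (z t $ j)) $ k)
        = cnj (complex_of_real (circ \<xi> $ k) / (z t $ j - z t $ k))" for k
    proof -
      have "(\<chi> j. - cnj (z t $ j)) $ j - (\<chi> j. - cnj (z t $ j)) $ k = - cnj (z t $ j - z t $ k)"
        by simp
      then show ?thesis using circ by (simp del: vec_lambda_beta complex_cnj_diff)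
    qed
    then show ?thesis by (simp add: S_def)
  qed
  moreover have "((\<lambda>s. - cnj (cnj (z s $ j))) has_vector_derivative
      - cnj (1 / (2 * complex_of_real pi * \<i>) * S + f t (z t $ j))) (at t)"
    by (intro has_vector_derivative_minus bounded_linear.has_vector_derivative[OF bounded_linear_cnj] z(3))
  moreover have "((\<lambda>s. - cnj (z s $ j - burst \<xi> s $ j)) has_vector_derivative - cnj E) (at t)"
    by (intro has_vector_derivative_minus bounded_linear.has_vector_derivative[OF bounded_linear_cnj] z(4))
  then have "((\<lambda>s. (\<chi> j. - cnj (z s $ j)) $ j - burst (- \<xi>) s $ j) has_vector_derivative - cnj E) (at t)"
    by (simp add: burst_reflect[OF assms(1)] algebra_simps)
  moreover have "norm (- cnj E) \<le> \<delta> / sqrt t" using z(5) by simp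
  ultimately show "(\<forall>k. j \<noteq> k \<longrightarrow> (\<chi> j. - cnj (z t $ j)) $ j \<noteq> (\<chi> j. - cnj (z t $ j)) $ k) \<and>
     norm ((\<chi> j. - cnj (z t $ j)) $ j) \<le> C * sqrt t \<and>
     ((\<lambda>s. cnj ((\<chi> j. - cnj (z s $ j)) $ j)) has_vector_derivative
        1 / (2 * complex_of_real pi * \<i>) *
          (\<Sum>k\<in>UNIV - {j}. complex_of_real (circ (- \<xi>) $ k) /
            ((\<chi> j. - cnj (z t $ j)) $ j - (\<chi> j. - cnj (z t $ j)) $ k)) +
        - cnj (f t (- cnj ((\<chi> j. - cnj (z t $ j)) $ j)))) (at t) \<and>
     (\<exists>E. ((\<lambda>s. (\<chi> j. - cnj (z s $ j)) $ j - burst (- \<xi>) s $ j) has_vector_derivative E) (at t) \<and>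
        norm E \<le> \<delta> / sqrt t)"
    using z(1,2) by (intro conjI exI[of _ "- cnj E"]) (simp_all add: algebra_simps)
qed

lemma lipschitz_force_reflect:
  assumes "lipschitz_force T M f"
  shows "lipschitz_force T M (\<lambda>t p. - cnj (f t (- cnj p)))"
proof -
  have "norm (- cnj x - - cnj y) = norm (x - y)" for x y
    by (metis complex_mod_cnj complex_cnj_diff minus_diff_minus norm_minus_cancel)
  then show ?thesis
    using assms unfolding lipschitz_force_def by (metis complex_mod_cnj norm_minus_cancel)
qed

lemma near_burst_exists:
  assumes \<xi>: "\<xi> \<noteq> 0"
  shows "\<exists>C>0. \<forall>M>0. \<forall>\<delta>>0. \<exists>T'>0. \<forall>T f. 0 < T \<longrightarrow> T < T' \<longrightarrow> lipschitz_force T M f \<longrightarrow>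
    (\<exists>z. near_burst \<xi> f T C \<delta> z)"
proof (cases "\<xi> > 0")
  case True
  then show ?thesis by (rule near_burst_exists_pos)
next
  case False
  then have neg: "- \<xi> > 0" using \<xi> by simp
  obtain C where C: "C > 0" "\<And>M \<delta>. M > 0 \<Longrightarrow> \<delta> > 0 \<Longrightarrow> \<exists>T'>0. \<forall>T f. 0 < T \<longrightarrow> T < T' \<longrightarrow>
      lipschitz_force T M f \<longrightarrow> (\<exists>z. near_burst (- \<xi>) f T C \<delta> z)"
    using near_burst_exists_pos[OF neg] by blast
  show ?thesis
  proof (rule exI[of _ C], intro conjI allI impI)
    fix M \<delta> :: real assume M: "M > 0" and \<delta>: "\<delta> > 0"
    obtain T' where T': "T' > 0" "\<And>T f. 0 < T \<Longrightarrow> T < T' \<Longrightarrow> lipschitz_force T M f \<Longrightarrow>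
        \<exists>z. near_burst (- \<xi>) f T C \<delta> z"
      using C(2)[OF M \<delta>] by blast
    have "\<exists>z. near_burst \<xi> f T C \<delta> z" if T: "0 < T" "T < T'" and f: "lipschitz_force T M f" for T f
    proof -
      \<comment> \<open>The force is reflected beforehand; reflection is an involution, so
        reflecting the solution restores \<open>f\<close>.\<close>
      obtain z where "near_burst (- \<xi>) (\<lambda>t p. - cnj (f t (- cnj p))) T C \<delta> z"
        using T'(2)[OF T lipschitz_force_reflect[OF f]] by (elim exE)
      from near_burst_reflect[OF _ this] show ?thesis using \<xi> by auto
    qed
    then show "\<exists>T'>0. \<forall>T f. 0 < T \<longrightarrow> T < T' \<longrightarrow> lipschitz_force T M f \<longrightarrow>
        (\<exists>z. near_burst \<xi> f T C \<delta> z)"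
      using T'(1) by blast
  qed (rule C(1))
qed

section \<open>Function space norms and Hoelder seminorms\<close>

lemma E_norm_imp_lipschitz_force:
  assumes T: "0 < T" and f: "f \<in> E_space T" "E_norm T f \<le> ennreal M" and M: "M > 0"
  shows "lipschitz_force T M f"
  unfolding lipschitz_force_def
proof (intro ballI allI conjI)
  fix t assume t: "t \<in> {0..<T}"
  have "C2_norm (f t) \<le> (SUP t\<in>{0..<T}. C2_norm (f t))" using t by (rule SUP_upper)
  also have "\<dots> \<le> E_norm T f" by (simp add: E_norm_def)
  finally have C2: "C2_norm (f t) \<le> ennreal M" using f(2) by simp
  show "norm (f t p) \<le> M" for p
  proof -
    have "ennreal (norm (f t p)) \<le> sup_norm (f t)"
      unfolding sup_norm_def by (rule SUP_upper) simp
    also have "\<dots> \<le> C2_norm (f t)" by (simp add: C2_norm_def add.assoc)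
    finally show ?thesis using C2 M by (simp add: order_trans[THEN ennreal_le_iff[THEN iffD1, rotated]])
  qed
  have diff: "f t differentiable (at p)" for p
    using f(1) t by (simp add: E_space_def C2_space_def)
  have D_le: "onorm (frechet_derivative (f t) (at p)) \<le> M" for p
  proof -
    \<comment> \<open>\<open>Blinfun\<close> inverts the coercion only on bounded linear maps, so
      this comes before the norm of \<open>Dreal\<close> is identified with an operator
      norm.\<close>
    have "bounded_linear (frechet_derivative (f t) (at p))"
      using diff frechet_derivative_works has_derivative_bounded_linear by blast
    then have "norm (Dreal (f t) p) = onorm (frechet_derivative (f t) (at p))"
      by (simp add: Dreal_def norm_blinfun.rep_eq bounded_linear_Blinfun_apply)
    moreover have "ennreal (norm (Dreal (f t) p)) \<le> sup_norm (Dreal (f t))"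
      unfolding sup_norm_def by (rule SUP_upper) simp
    moreover have "sup_norm (Dreal (f t)) \<le> C2_norm (f t)"
      unfolding C2_norm_def by (metis add.commute add.left_commute le_iff_add)
    ultimately have "ennreal (onorm (frechet_derivative (f t) (at p))) \<le> ennreal M"
      using C2 by (metis order_trans)
    then show ?thesis using M by (simp add: ennreal_le_iff)
  qed
  show "norm (f t p - f t q) \<le> M * norm (p - q)" for p q
    by (rule differentiable_bound[of UNIV "f t" "\<lambda>p. frechet_derivative (f t) (at p)"])
      (use diff D_le in \<open>auto simp flip: frechet_derivative_works\<close>)
  fix s assume s: "s \<in> {0..<T}"
  show "norm (f t p - f s p) \<le> M * \<bar>t - s\<bar>" for p
  \<comment> \<open>The seminorm ranges over distinct times only; the diagonal is treated
    apart.\<close>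
  proof (cases "s = t")
    case False
    then have pos: "\<bar>t - s\<bar> > 0" by simp
    have "ennreal (norm (f t p - f s p) / \<bar>t - s\<bar>) = ennreal (norm ((f t - f s) p)) / ennreal (\<bar>t - s\<bar> powr 1)"
      using pos by (simp add: divide_ennreal)
    also have "\<dots> \<le> sup_norm (f t - f s) / ennreal (\<bar>t - s\<bar> powr 1)"
      unfolding sup_norm_def by (intro divide_right_mono_ennreal SUP_upper) simp
    also have "\<dots> \<le> holder_seminorm sup_norm 1 {0..<T} f"
      unfolding holder_seminorm_def
      by (rule SUP_upper2[of "(s, t)"]) (use s t False in auto)
    also have "\<dots> \<le> E_norm T f" by (simp add: E_norm_def)
    also have "\<dots> \<le> ennreal M" by (rule f(2))
    finally show ?thesis using M pos by (simp add: ennreal_le_iff pos_divide_le_eq)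
  qed simp
qed

text \<open>The difference quotient between \<open>s\<close> and 1 tends to |w_j(1)| = |a_j| sqrt
  (2a) as \<open>s\<close> tends to 0, and |a_j| \<ge> 1. A limit is taken because 0 is outside the
  domain of the seminorm.\<close>

lemma burst_seminorm_ge:
  assumes "\<xi> \<noteq> 0"
  shows "ennreal (sqrt (2 * burst_a \<xi>)) \<le> C_half_seminorm {0<..} (\<lambda>t. burst \<xi> t $ j)"
proof -
  let ?w = "\<lambda>t. burst \<xi> t $ j" and ?N = "C_half_seminorm {0<..} (\<lambda>t. burst \<xi> t $ j)"
  have a: "burst_a \<xi> > 0" by (rule burst_a_pos[OF assms])
  have Z: "norm (burst_Z \<xi> t) = sqrt (2 * burst_a \<xi>) * sqrt t" if "t > 0" for t
    using a that by (simp add: burst_Z_def norm_mult real_sqrt_mult)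
  have "\<forall>j. 1 \<le> norm (burst_coeff \<xi> $ j)"
  proof -
    have "1 \<le> norm x" if "Re x = 2 \<or> Re x = - 2" for x
      using abs_Re_le_cmod[of x] that by auto
    then show ?thesis
      unfolding forall_3 by (auto simp: burst_coeff_def)
  qed
  then have "1 * sqrt (2 * burst_a \<xi>) \<le> norm (burst_coeff \<xi> $ j) * sqrt (2 * burst_a \<xi>)"
    using a by (intro mult_right_mono) auto
  then have w1: "sqrt (2 * burst_a \<xi>) \<le> norm (?w 1)"
    using Z[of 1] by (simp add: burst_def norm_mult)
  have "((\<lambda>s. norm (burst_coeff \<xi> $ j) * (sqrt (2 * burst_a \<xi>) * sqrt s)) \<longlongrightarrow>
      norm (burst_coeff \<xi> $ j) * (sqrt (2 * burst_a \<xi>) * sqrt 0)) (at_right 0)"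
    by (intro tendsto_intros)
  moreover have "\<forall>\<^sub>F s in at_right 0. norm (burst_coeff \<xi> $ j) * (sqrt (2 * burst_a \<xi>) * sqrt s) = norm (?w s)"
    by (rule eventually_at_rightI[of 0 1]) (use Z in \<open>auto simp: burst_def norm_mult\<close>)
  ultimately have "((\<lambda>s. norm (?w s)) \<longlongrightarrow> 0) (at_right 0)"
    by (simp add: filterlim_cong)
  then have "(?w \<longlongrightarrow> 0) (at_right 0)"
    by (rule tendsto_norm_zero_cancel)
  then have "((\<lambda>s. norm (?w 1 - ?w s) / (1 - s) powr (1 / 2)) \<longlongrightarrow> norm (?w 1 - 0) / (1 - 0) powr (1 / 2)) (at_right 0)"
    by (intro tendsto_intros) auto
  then have "((\<lambda>s. ennreal (norm (?w 1 - ?w s) / (1 - s) powr (1 / 2))) \<longlongrightarrow> ennreal (norm (?w 1))) (at_right 0)"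
    by (intro tendsto_ennrealI) simp
  moreover have "\<forall>\<^sub>F s in at_right 0. ennreal (norm (?w 1 - ?w s) / (1 - s) powr (1 / 2)) \<le> ?N"
  proof (rule eventually_at_rightI[of 0 1])
    fix s :: real assume s: "s \<in> {0<..<1}"
    have "ennreal (norm (?w 1 - ?w s) / (1 - s) powr (1 / 2))
        = ennreal (norm (?w 1 - ?w s)) / ennreal (\<bar>1 - s\<bar> powr (1 / 2))"
      using s by (simp add: divide_ennreal)
    also have "\<dots> \<le> ?N"
      unfolding holder_seminorm_def by (rule SUP_upper2[of "(s, 1)"]) (use s in auto)
    finally show "ennreal (norm (?w 1 - ?w s) / (1 - s) powr (1 / 2)) \<le> ?N" .
  qed simp
  ultimately have "ennreal (norm (?w 1)) \<le> ?N"
    by (intro tendsto_upperbound) auto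
  then show ?thesis
    using w1 order_trans ennreal_leI by blast
qed

text \<open>The mean value inequality compares \<open>r\<close> with
  \<open>2 * \<delta> * sqrt x\<close>, whose derivative is \<open>\<delta> / sqrt x\<close>.
  Subadditivity of the square root finishes.\<close>

lemma sqrt_holder:
  assumes "0 < s" "s < t" "t < T"
    and "\<And>x. x \<in> {0<..<T} \<Longrightarrow> (r has_vector_derivative E x) (at x) \<and> norm (E x) \<le> \<delta> / sqrt x"
    and "\<delta> \<ge> 0"
  shows "norm (r t - r s) \<le> 2 * \<delta> * sqrt (t - s)"
proof -
  have "norm (r t - r s) \<le> 2 * \<delta> * sqrt t - 2 * \<delta> * sqrt s"
  proof (rule differentiable_bound_general[OF assms(2)])
    have "isCont r x" if "x \<in> {0<..<T}" for x
      using assms(4)[OF that] has_vector_derivative_continuous by blast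
    then have "continuous_on {0<..<T} r"
      by (auto intro!: continuous_at_imp_continuous_on)
    then show "continuous_on {s..t} r"
      by (rule continuous_on_subset) (use assms in auto)
    show "continuous_on {s..t} (\<lambda>x. 2 * \<delta> * sqrt x)"
      by (intro continuous_intros)
    fix x assume x: "s < x" "x < t"
    then show "(r has_vector_derivative E x) (at x)" "norm (E x) \<le> \<delta> / sqrt x"
      using assms by auto
    have "((\<lambda>x. 2 * \<delta> * sqrt x) has_real_derivative \<delta> / sqrt x) (at x)"
      using x assms(1) by (auto intro!: derivative_eq_intros simp: field_simps)
    then show "((\<lambda>x. 2 * \<delta> * sqrt x) has_vector_derivative \<delta> / sqrt x) (at x)"
      by (simp add: has_real_derivative_iff_has_vector_derivative)
  qed
  also have "\<dots> = 2 * \<delta> * (sqrt t - sqrt s)" by (simp add: algebra_simps)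
  also have "\<dots> \<le> 2 * \<delta> * sqrt (t - s)"
    using sqrt_add_le_add_sqrt[of "t - s" s] assms by (intro mult_left_mono) auto
  finally show ?thesis .
qed

lemma half_seminorm_le:
  assumes "\<And>s t. s \<in> I \<Longrightarrow> t \<in> I \<Longrightarrow> s < t \<Longrightarrow> norm ((g t - h t) - (g s - h s)) \<le> c * sqrt (t - s)"
    and "I \<subseteq> I'" "c \<ge> 0"
  shows "C_half_seminorm I g \<le> C_half_seminorm I' h + ennreal c"
  unfolding holder_seminorm_def[of _ _ I]
proof (rule SUP_least, clarify)
  fix s t assume st: "s \<in> I" "t \<in> I" "s \<noteq> t"
  let ?d = "ennreal (\<bar>t - s\<bar> powr (1 / 2))"
  have pos: "\<bar>t - s\<bar> powr (1 / 2) > 0" using st by simp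
  have "norm ((g t - h t) - (g s - h s)) \<le> c * sqrt \<bar>t - s\<bar>"
    using assms(1)[OF st(1,2)] assms(1)[OF st(2,1)] st(3)
    by (cases s t rule: linorder_cases) (auto simp: norm_minus_commute)
  then have "norm ((g t - h t) - (g s - h s)) \<le> c * \<bar>t - s\<bar> powr (1 / 2)"
    by (simp add: powr_half_sqrt)
  moreover have "norm (g t - g s) \<le> norm (h t - h s) + norm ((g t - h t) - (g s - h s))"
    using norm_triangle_ineq[of "h t - h s" "(g t - h t) - (g s - h s)"] by simp
  ultimately have "norm (g t - g s) \<le> norm (h t - h s) + c * \<bar>t - s\<bar> powr (1 / 2)"
    by linarith
  then have "ennreal (norm (g t - g s)) / ?d \<le> ennreal (norm (h t - h s) + c * \<bar>t - s\<bar> powr (1 / 2)) / ?d"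
    by (intro divide_right_mono_ennreal ennreal_leI)
  also have "\<dots> = ennreal (norm (h t - h s)) / ?d + ennreal c"
    using pos assms(3) by (simp add: divide_ennreal add_divide_distrib flip: ennreal_plus)
  also have "\<dots> \<le> C_half_seminorm I' h + ennreal c"
    unfolding holder_seminorm_def
    by (intro add_right_mono SUP_upper2[of "(s, t)"]) (use st assms(2) in auto)
  finally show "ennreal (norm (g t - g s)) / ?d \<le> C_half_seminorm I' h + ennreal c" .
qed

lemma has_vector_derivative_vec:
  fixes z :: "real \<Rightarrow> 'a::euclidean_space ^ 'n"
  assumes "\<And>j. ((\<lambda>t. z t $ j) has_vector_derivative D $ j) (at t)"
  shows "(z has_vector_derivative D) (at t)"
  unfolding has_vector_derivative_def
proof (subst has_derivative_componentwise_within, rule ballI)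
  fix i :: "'a ^ 'n" assume "i \<in> Basis"
  then obtain k b where i: "i = axis k b" by (auto simp: Basis_vec_def)
  show "((\<lambda>x. z x \<bullet> i) has_derivative (\<lambda>x. (x *\<^sub>R D) \<bullet> i)) (at t)"
    using has_derivative_inner_left[OF assms[of k, unfolded has_vector_derivative_def], of b]
    by (simp add: i inner_axis)
qed

theorem proposition2p3:
  fixes \<xi> :: real
  assumes "\<xi> \<noteq> 0"
  shows "\<forall>M::real. \<forall>\<rho>::real. M > 0 \<and> \<rho> > 0 \<longrightarrow>
    (\<exists>T'>0. \<forall>T. 0 < T \<and> T < T' \<longrightarrow> (\<forall>f\<in>E_space T. E_norm T f \<le> ennreal M \<longrightarrow>
      (\<exists>z :: real \<Rightarrow> complex ^ 3.
        z ` {0<..<T} \<subseteq> - diagonal3 \<and>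
        z C1_differentiable_on {0<..<T} \<and>
        (\<forall>t\<in>{0<..<T}. \<forall>j.
          ((\<lambda>s. cnj (z s $ j)) has_vector_derivative
             (1 / (2 * complex_of_real pi * \<i>) *
               (\<Sum>k\<in>UNIV - {j}. complex_of_real (circ \<xi> $ k) / (z t $ j - z t $ k)) +
              f t (z t $ j))) (at t)) \<and>
        (\<forall>j. ((\<lambda>t. z t $ j) \<longlongrightarrow> 0) (at_right 0)) \<and>
        (\<forall>j. C_half_seminorm {0<..<T} (\<lambda>t. z t $ j)
               \<le> 3 * C_half_seminorm {0<..} (\<lambda>t. burst \<xi> t $ j)) \<and>
        (SUP t\<in>{0<..<T}. ennreal (norm (z t))) \<le> ennreal \<rho>)))"
proof (intro allI impI, elim conjE)
  fix M \<rho> :: real assume M: "M > 0" and \<rho>: "\<rho> > 0"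
  \<comment> \<open>This is the lower bound in \<open>burst_seminorm_ge\<close>, so the extra
    \<open>2 * \<delta>\<close> is absorbed by two further copies of the burst seminorm.\<close>
  define \<delta> where "\<delta> = sqrt (2 * burst_a \<xi>)"
  have \<delta>: "\<delta> > 0" using burst_a_pos[OF assms] by (simp add: \<delta>_def)
  obtain C where C: "C > 0" and ex: "\<forall>M>0. \<forall>\<delta>>0. \<exists>T'>0. \<forall>T f. 0 < T \<longrightarrow> T < T' \<longrightarrow> lipschitz_force T M f \<longrightarrow>
      (\<exists>z. near_burst \<xi> f T C \<delta> z)"
    using near_burst_exists[OF assms] by blast
  obtain T1 where T1: "T1 > 0" "\<And>T f. 0 < T \<Longrightarrow> T < T1 \<Longrightarrow> lipschitz_force T M f \<Longrightarrow>
      \<exists>z. near_burst \<xi> f T C \<delta> z"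
    using ex[THEN spec, THEN mp, OF M, THEN spec, THEN mp, OF \<delta>] by blast
  \<comment> \<open>The norm of \<open>z t\<close> is at most the sum of three components, each at
    most \<open>C * sqrt t\<close>; the second entry makes that sum at most
    \<open>\<rho>\<close>.\<close>
  define T' where "T' = min T1 ((\<rho> / (3 * C))\<^sup>2)"
  have "T' > 0" using T1(1) \<rho> C by (simp add: T'_def)
  moreover have "\<exists>z :: real \<Rightarrow> complex ^ 3.
        z ` {0<..<T} \<subseteq> - diagonal3 \<and>
        z C1_differentiable_on {0<..<T} \<and>
        (\<forall>t\<in>{0<..<T}. \<forall>j.
          ((\<lambda>s. cnj (z s $ j)) has_vector_derivative
             (1 / (2 * complex_of_real pi * \<i>) *
               (\<Sum>k\<in>UNIV - {j}. complex_of_real (circ \<xi> $ k) / (z t $ j - z t $ k)) +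
              f t (z t $ j))) (at t)) \<and>
        (\<forall>j. ((\<lambda>t. z t $ j) \<longlongrightarrow> 0) (at_right 0)) \<and>
        (\<forall>j. C_half_seminorm {0<..<T} (\<lambda>t. z t $ j)
               \<le> 3 * C_half_seminorm {0<..} (\<lambda>t. burst \<xi> t $ j)) \<and>
        (SUP t\<in>{0<..<T}. ennreal (norm (z t))) \<le> ennreal \<rho>"
    if T: "0 < T" "T < T'" and f: "f \<in> E_space T" "E_norm T f \<le> ennreal M" for T f
  proof -
    have force: "lipschitz_force T M f"
      by (rule E_norm_imp_lipschitz_force[OF T(1) f M])
    then obtain z where z: "near_burst \<xi> f T C \<delta> z"
      using T1(2) T by (auto simp: T'_def)
    let ?I = "{0<..<T}"
    define R where "R = (\<lambda>t j. 1 / (2 * complex_of_real pi * \<i>) *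
      (\<Sum>k\<in>UNIV - {j}. complex_of_real (circ \<xi> $ k) / (z t $ j - z t $ k)) + f t (z t $ j))"
    have distinct: "z t $ j \<noteq> z t $ k" if "t \<in> ?I" "j \<noteq> k" for t j k
      using z that unfolding near_burst_def by blast
    have le: "norm (z t $ j) \<le> C * sqrt t" if "t \<in> ?I" for t j
      using z that unfolding near_burst_def by blast
    have ode: "((\<lambda>s. cnj (z s $ j)) has_vector_derivative R t j) (at t)" if "t \<in> ?I" for t j
      using z that unfolding near_burst_def R_def by blast
    \<comment> \<open>\<open>sqrt_holder\<close> needs the derivative as a function of time, so the
      pointwise witnesses are collected by choice.\<close>
    define E where "E = (\<lambda>j t. SOME E. ((\<lambda>s. z s $ j - burst \<xi> s $ j) has_vector_derivative E) (at t) \<and>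
      norm E \<le> \<delta> / sqrt t)"
    have E: "((\<lambda>s. z s $ j - burst \<xi> s $ j) has_vector_derivative E j t) (at t) \<and> norm (E j t) \<le> \<delta> / sqrt t"
      if "t \<in> ?I" for j t
      unfolding E_def by (rule someI_ex) (use z that in \<open>unfold near_burst_def, blast\<close>)
    have avoid: "z ` ?I \<subseteq> - diagonal3"
      using distinct by (fastforce simp: diagonal3_def)
    have smooth: "z C1_differentiable_on ?I"
    proof -
      have deriv: "(z has_vector_derivative (\<chi> j. cnj (R t j))) (at t)" if "t \<in> ?I" for t
      proof (rule has_vector_derivative_vec)
        show "((\<lambda>s. z s $ j) has_vector_derivative (\<chi> j. cnj (R t j)) $ j) (at t)" for j
          using bounded_linear.has_vector_derivative[OF bounded_linear_cnj ode[OF that, of j]] by simp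
      qed
      then have "isCont z t" if "t \<in> ?I" for t
        using that has_vector_derivative_continuous by blast
      then have "continuous_on ?I z"
        by (auto intro!: continuous_at_imp_continuous_on)
      then have cz: "continuous_on ?I (\<lambda>t. z t $ j)" for j
        by (intro continuous_intros)
      \<comment> \<open>Joint continuity of the extension is reused, now for continuity of the force
        along the trajectory and hence of the derivative.\<close>
      obtain g where g: "continuous_on ({0..T} \<times> UNIV) g" "\<And>t p. t \<in> {0..<T} \<Longrightarrow> g (t, p) = f t p"
        by (rule time_lipschitz_extension[OF T(1), of f M]) (use force in \<open>auto simp: lipschitz_force_def\<close>)
      have "continuous_on ?I (\<lambda>t. g (t, z t $ j))" for j
        by (rule continuous_on_compose2[OF g(1)]) (auto intro!: continuous_intros cz)
      then have "continuous_on ?I (\<lambda>t. f t (z t $ j))" for j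
        by (rule continuous_on_eq) (simp add: g(2))
      moreover have "continuous_on ?I (\<lambda>t. \<Sum>k\<in>UNIV - {j}. complex_of_real (circ \<xi> $ k) / (z t $ j - z t $ k))" for j
        by (intro continuous_on_sum continuous_on_divide continuous_on_const continuous_on_diff cz)
          (use distinct in auto)
      ultimately have "continuous_on ?I (\<lambda>t. R t j)" for j
        unfolding R_def by (intro continuous_on_add continuous_on_mult continuous_on_const)
      then have "continuous_on ?I (\<lambda>t. \<chi> j. cnj (R t j))"
        by (intro continuous_on_vec_lambda continuous_on_cnj)
      then show ?thesis
        unfolding C1_differentiable_on_def
        by (intro exI[of _ "\<lambda>t. \<chi> j. cnj (R t j)"] conjI ballI deriv)
    qed
    have limit: "((\<lambda>t. z t $ j) \<longlongrightarrow> 0) (at_right 0)" for j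
    proof (rule Lim_null_comparison)
      show "\<forall>\<^sub>F t in at_right 0. norm (z t $ j) \<le> C * sqrt t"
        using T(1) le by (intro eventually_at_rightI[of 0 T]) auto
      have "((\<lambda>t. C * sqrt t) \<longlongrightarrow> C * sqrt 0) (at_right 0)"
        by (intro tendsto_intros)
      then show "((\<lambda>t. C * sqrt t) \<longlongrightarrow> 0) (at_right 0)" by simp
    qed
    have holder: "C_half_seminorm ?I (\<lambda>t. z t $ j) \<le> 3 * C_half_seminorm {0<..} (\<lambda>t. burst \<xi> t $ j)" for j
    proof -
      let ?W = "C_half_seminorm {0<..} (\<lambda>t. burst \<xi> t $ j)"
      have "C_half_seminorm ?I (\<lambda>t. z t $ j) \<le> ?W + ennreal (2 * \<delta>)"
      proof (rule half_seminorm_le)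
        fix s t assume "s \<in> ?I" "t \<in> ?I" "s < t"
        then show "norm ((z t $ j - burst \<xi> t $ j) - (z s $ j - burst \<xi> s $ j)) \<le> 2 * \<delta> * sqrt (t - s)"
          by (intro sqrt_holder[where T = T and E = "E j" and r = "\<lambda>t. z t $ j - burst \<xi> t $ j"] E)
            (use \<delta> in auto)
      qed (use \<delta> in auto)
      also have "ennreal (2 * \<delta>) = 2 * ennreal \<delta>"
        using \<delta> by (simp add: ennreal_mult)
      also have "?W + 2 * ennreal \<delta> \<le> ?W + 2 * ?W"
        unfolding \<delta>_def by (intro add_left_mono mult_left_mono burst_seminorm_ge[OF assms]) auto
      also have "\<dots> = 3 * ?W"
        using distrib_right[of 1 2 ?W] by simp
      finally show ?thesis .
    qed
    have bound: "(SUP t\<in>?I. ennreal (norm (z t))) \<le> ennreal \<rho>"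
    proof (rule SUP_least, rule ennreal_leI)
      fix t assume t: "t \<in> ?I"
      have "norm (z t) \<le> (\<Sum>j\<in>UNIV. norm (z t $ j))"
        unfolding norm_vec_def by (rule L2_set_le_sum) simp
      also have "\<dots> \<le> 3 * (C * sqrt t)"
        unfolding sum_3 using le[OF t, of 1] le[OF t, of 2] le[OF t, of 3] by linarith
      also have "\<dots> \<le> 3 * (C * (\<rho> / (3 * C)))"
      proof -
        have "sqrt t \<le> sqrt ((\<rho> / (3 * C))\<^sup>2)"
          by (rule real_sqrt_le_mono) (use t T in \<open>simp add: T'_def\<close>)
        then have "sqrt t \<le> \<rho> / (3 * C)" using C \<rho> by simp
        then show ?thesis using C by (intro mult_left_mono) auto
      qed
      also have "\<dots> = \<rho>" using C by simp
      finally show "norm (z t) \<le> \<rho>" .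
    qed
    show ?thesis
      by (rule exI[of _ z]) (intro conjI ballI allI avoid smooth ode[unfolded R_def] limit holder bound)
  qed
  ultimately show "\<exists>T'>0. \<forall>T. 0 < T \<and> T < T' \<longrightarrow> (\<forall>f\<in>E_space T. E_norm T f \<le> ennreal M \<longrightarrow>
      (\<exists>z :: real \<Rightarrow> complex ^ 3.
        z ` {0<..<T} \<subseteq> - diagonal3 \<and>
        z C1_differentiable_on {0<..<T} \<and>
        (\<forall>t\<in>{0<..<T}. \<forall>j.
          ((\<lambda>s. cnj (z s $ j)) has_vector_derivative
             (1 / (2 * complex_of_real pi * \<i>) *
               (\<Sum>k\<in>UNIV - {j}. complex_of_real (circ \<xi> $ k) / (z t $ j - z t $ k)) +
              f t (z t $ j))) (at t)) \<and>
        (\<forall>j. ((\<lambda>t. z t $ j) \<longlongrightarrow> 0) (at_right 0)) \<and>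
        (\<forall>j. C_half_seminorm {0<..<T} (\<lambda>t. z t $ j)
               \<le> 3 * C_half_seminorm {0<..} (\<lambda>t. burst \<xi> t $ j)) \<and>
        (SUP t\<in>{0<..<T}. ennreal (norm (z t))) \<le> ennreal \<rho>))"
    by blast
qed

end
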